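(* Fix $r\ge1$, indeterminates $x=(x_0,\dots,x_r)$, and let $G$ and $F$ be the power series defined below. Let $y=(y_0,\dots,y_r)$ be the formal power series in $x_0,\dots,x_r$ with zero constant terms uniquely determined by $$x_j=\frac{y_j(1+y_j)}{E(y)^2}\quad(0\le j\le r),\qquad E(y)=\prod_{i=0}^r(1+y_i),$$ let $t=zE(y)^2$, let $E(y,u)=\prod_{i=0}^r(1+y_iu)$, and let $c(t)=\frac{1-\sqrt{1-4t}}{2t}$. Then $$G=\frac{c(t)E(y)}{E(y,c(t))},\qquad F=\frac{E(y)}{t}\left(E(y)-\frac{E(y,c(t))}{c(t)}\right).$$
   Context: An $r$-permutation of a finite set $A$ of positive integers is a word in which each element of $A$ appears exactly $r$ times such that whenever $i<j<k$ and $a_i=a_k$ we have $a_j\le a_i$. A $k$-tuple $r$-permutation of $[n]$ is a tuple $(\alpha_1,\dots,\alpha_k)$ of words whose concatenation is an $r$-permutation of $[n]$ and in which every letter appears in only one $\alpha_i$. Stack sorting $S$: on words with distinct letters, $S(\emptyset)=\emptyset$ and $S(\pi_lm\pi_r)=S(\pi_l)S(\pi_r)m$ with $m$ the largest letter; on a nonempty $r$-permutation with largest letter $m$, written $\alpha_1m\alpha_2m\cdots m\alpha_{r+1}$, $S(\pi)=S(\alpha_1)\cdots S(\alpha_{r+1})m$. The tuple is two-stack-sortable if $S(S(\alpha_1)\cdots S(\alpha_k))=12\cdots n$. A letter $a$ of an $r$-permutation is a type $i$ descent ($1\le i\le r$) if its $i$th occurrence is immediately followed by a smaller letter, and a type $0$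 descent if its first occurrence immediately follows a smaller letter; for a tuple, descent sets are unions over the components, and its weight is $\prod_i x_i^{(\#\text{type } i \text{ descents})}$. $g_n^{(k)}$ is the sum of the weights of all two-stack-sortable $k$-tuple $r$-permutations of $[n]$ with all components nonempty, $g_k=\sum_n g_n^{(k)}$, $G=\sum_{k\ge0}g_kz^k$, $f_k=\sum_{j\ge0}g_{k+j}e_j(x)$ with $e_j$ the $j$th elementary symmetric polynomial in $x_0,\dots,x_r$, and $F=\sum_{k\ge0}f_kz^k$. *)

theory Defs
  imports
    "HOL-Computational_Algebra.Formal_Power_Series"
    "HOL-Library.Multiset"
    "HOL-Library.FuncSet"
begin

section \<open>Multivariate formal power series\<close>

text \<open>A monomial in variables of type \<open>'v\<close> is a multiset over \<open>'v\<close>: \<open>count m v\<close> is the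
  exponent of \<open>v\<close>, multiset sum is multiplication of monomials and \<open>size\<close> is the total degree.\<close>

typedef ('v, 'a) mfps = "UNIV :: ('v multiset \<Rightarrow> 'a) set"
  morphisms mcoeff Abs_mfps ..

lemma mcoeff_Abs_mfps [simp]: "mcoeff (Abs_mfps f) = f"
  by (simp add: Abs_mfps_inverse)

lemma mfps_eqI: "(\<And>m. mcoeff f m = mcoeff g m) \<Longrightarrow> f = g"
  by (metis ext mcoeff_inject)

lemma finite_mset_splits: "finite {(a, b). a + b = (m :: 'v multiset)}"
proof (induction m)
  case empty
  have "{(a, b). a + b = ({#} :: 'v multiset)} = {({#}, {#})}" by auto
  then show ?case by simp
next
  case (add x m)
  let ?P = "{(a, b). a + b = m}"
  have "{(a, b). a + b = add_mset x m} \<subseteq>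
      (\<lambda>(a, b). (add_mset x a, b)) ` ?P \<union> (\<lambda>(a, b). (a, add_mset x b)) ` ?P"
  proof clarify
    fix a b assume eq: "a + b = add_mset x m"
      and not: "(a, b) \<notin> (\<lambda>(a, b). (a, add_mset x b)) ` ?P"
    have "x \<in># a + b" by (simp add: eq)
    then have "x \<in># a \<or> x \<in># b" by simp
    then show "(a, b) \<in> (\<lambda>(a, b). (add_mset x a, b)) ` ?P"
    proof
      assume "x \<in># a"
      then obtain a' where "a = add_mset x a'" by (metis insert_DiffM)
      with eq show ?thesis by (auto simp: image_iff)
    next
      assume "x \<in># b"
      then obtain b' where "b = add_mset x b'" by (metis insert_DiffM)
      with eq not show ?thesis by (auto simp: image_iff)
    qed
  qed
  with add.IH show ?case by (meson finite_UnI finite_imageI finite_subset)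
qed

instantiation mfps :: (type, comm_ring_1) comm_ring_1
begin

definition "0 = Abs_mfps (\<lambda>_. 0)"
definition "1 = Abs_mfps (\<lambda>m. if m = {#} then 1 else 0)"
definition "f + g = Abs_mfps (\<lambda>m. mcoeff f m + mcoeff g m)"
definition "f - g = Abs_mfps (\<lambda>m. mcoeff f m - mcoeff g m)"
definition "- f = Abs_mfps (\<lambda>m. - mcoeff f m)"
definition "f * g = Abs_mfps (\<lambda>m. \<Sum>(a, b) | a + b = m. mcoeff f a * mcoeff g b)"

instance
proof
  fix f g h :: "('a, 'b) mfps"
  show "f * g * h = f * (g * h)"
  proof (rule mfps_eqI)
    fix m
    have "mcoeff (f * g * h) m =
        (\<Sum>q\<in>{(a, b). a + b = m}. \<Sum>p\<in>{(a, b). a + b = fst q}.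
          mcoeff f (fst p) * mcoeff g (snd p) * mcoeff h (snd q))"
      by (simp add: times_mfps_def case_prod_beta sum_distrib_right)
    also have "\<dots> = (\<Sum>(q, p)\<in>Sigma {(a, b). a + b = m} (\<lambda>q. {(a, b). a + b = fst q}).
          mcoeff f (fst p) * mcoeff g (snd p) * mcoeff h (snd q))"
      by (rule sum.Sigma) (auto intro: finite_mset_splits)
    also have "\<dots> = (\<Sum>(q, p)\<in>Sigma {(a, b). a + b = m} (\<lambda>q. {(a, b). a + b = snd q}).
          mcoeff f (fst q) * (mcoeff g (fst p) * mcoeff h (snd p)))"
      by (rule sum.reindex_bij_witness
            [where i = "\<lambda>((a, bc), (b, c)). ((a + b, c), (a, b))"
               and j = "\<lambda>((ab, c), (a, b)). ((a, b + c), (b, c))"])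
        (auto simp: mult.assoc add.assoc)
    also have "\<dots> = (\<Sum>q\<in>{(a, b). a + b = m}. \<Sum>p\<in>{(a, b). a + b = snd q}.
          mcoeff f (fst q) * (mcoeff g (fst p) * mcoeff h (snd p)))"
      by (rule sum.Sigma [symmetric]) (auto intro: finite_mset_splits)
    also have "\<dots> = mcoeff (f * (g * h)) m"
      by (simp add: times_mfps_def case_prod_beta sum_distrib_left)
    finally show "mcoeff (f * g * h) m = mcoeff (f * (g * h)) m" .
  qed
  show "f * g = g * f"
    unfolding times_mfps_def
    by (rule arg_cong [where f = Abs_mfps], rule ext,
        rule sum.reindex_bij_witness [where i = prod.swap and j = prod.swap])
      (auto simp: ac_simps)
  show "1 * f = f"
  proof (rule mfps_eqI)
    fix m
    have "mcoeff (1 * f) m = (\<Sum>(a, b) | a + b = m. if a = {#} then mcoeff f b else 0)"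
      by (simp add: times_mfps_def one_mfps_def case_prod_beta if_distrib [of "\<lambda>x. x * _"] cong: if_cong)
    also have "\<dots> = (\<Sum>p\<in>{({#} :: 'a multiset, m)}. mcoeff f m)"
      by (rule sum.mono_neutral_cong_right) (auto intro: finite_mset_splits split: if_splits)
    finally show "mcoeff (1 * f) m = mcoeff f m" by simp
  qed
  show "(f + g) * h = f * h + g * h"
    by (rule mfps_eqI)
      (simp add: times_mfps_def plus_mfps_def case_prod_beta distrib_right sum.distrib)
  show "(0 :: ('a, 'b) mfps) \<noteq> 1"
  proof
    assume "(0 :: ('a, 'b) mfps) = 1"
    then have "mcoeff (0 :: ('a, 'b) mfps) {#} = mcoeff 1 {#}" by simp
    then show False by (simp add: zero_mfps_def one_mfps_def)
  qed
qed (auto intro!: mfps_eqI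
    simp: plus_mfps_def minus_mfps_def uminus_mfps_def zero_mfps_def ac_simps)

end

definition mconst :: "'a \<Rightarrow> ('v, 'a :: comm_ring_1) mfps" where
  "mconst a = Abs_mfps (\<lambda>m. if m = {#} then a else 0)"

definition mvar :: "'v \<Rightarrow> ('v, 'a :: comm_ring_1) mfps" where
  "mvar v = Abs_mfps (\<lambda>m. if m = {#v#} then 1 else 0)"

definition mvars_in :: "'v set \<Rightarrow> ('v, 'a :: comm_ring_1) mfps \<Rightarrow> bool" where
  "mvars_in V f \<longleftrightarrow> (\<forall>m. mcoeff f m \<noteq> 0 \<longrightarrow> set_mset m \<subseteq> V)"

text \<open>The inverse is \<open>a * (\<Sum>k. (1 - a f)^k)\<close> with \<open>a\<close> the inverse of the constant
  coefficient of \<open>f\<close>; the powers with \<open>k > size m\<close> do not contribute to the coefficient at \<open>m\<close>.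
  It is \<open>0\<close> if the constant coefficient vanishes.\<close>

instantiation mfps :: (type, field) inverse
begin

definition inverse_mfps_def: "inverse f =
  (let a = mconst (inverse (mcoeff f {#}))
   in a * Abs_mfps (\<lambda>m. \<Sum>k\<le>size m. mcoeff ((1 - a * f) ^ k) m))"

definition divide_mfps_def: "f div g = f * inverse (g :: ('a, 'b) mfps)"

instance ..

end

lemma mcoeff_power_eq_0:
  assumes "mcoeff h {#} = 0" and "size m < k"
  shows "mcoeff (h ^ k) m = 0"
  using assms(2)
proof (induction k arbitrary: m)
  case (Suc k)
  have "mcoeff h a * mcoeff (h ^ k) b = 0" if "a + b = m" for a b
  proof (cases "a = {#}")
    case False
    then have "size b < k" using that Suc.prems by (auto simp: nonempty_has_size)
    then show ?thesis using Suc.IH by simp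
  qed (simp add: assms(1))
  then show ?case by (auto simp: times_mfps_def intro!: sum.neutral)
qed simp

lemma mcoeff_mult_empty: "mcoeff (f * g) {#} = mcoeff f {#} * mcoeff g {#}"
proof -
  have "{(a, b). a + b = ({#} :: 'a multiset)} = {({#}, {#})}" by auto
  then show ?thesis by (simp add: times_mfps_def)
qed

lemma mfps_inverse_right:
  fixes f :: "('v, 'a :: field) mfps"
  assumes "mcoeff f {#} \<noteq> 0"
  shows "f * inverse f = 1"
proof -
  define a :: "('v, 'a) mfps" where "a = mconst (inverse (mcoeff f {#}))"
  define h where "h = 1 - a * f"
  define S where "S = Abs_mfps (\<lambda>m. \<Sum>k\<le>size m. mcoeff (h ^ k) m)"
  have h0: "mcoeff h {#} = 0"
    using assms
    by (simp add: h_def minus_mfps_def mcoeff_mult_empty) (simp add: one_mfps_def a_def mconst_def)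
  have S_eq: "mcoeff S q = (\<Sum>k\<le>N. mcoeff (h ^ k) q)" if "size q \<le> N" for q N
    unfolding S_def using that
    by (simp, intro sum.mono_neutral_left) (auto intro: mcoeff_power_eq_0 [OF h0])
  have "h * S = S - 1"
  proof (rule mfps_eqI)
    fix m
    have "mcoeff (h * S) m =
        (\<Sum>(p, q) | p + q = m. mcoeff h p * (\<Sum>k\<le>size m. mcoeff (h ^ k) q))"
      unfolding times_mfps_def mcoeff_Abs_mfps
      by (rule sum.cong) (auto simp: S_eq)
    also have "\<dots> = (\<Sum>k\<le>size m. mcoeff (h ^ Suc k) m)"
      unfolding power_Suc times_mfps_def mcoeff_Abs_mfps
      by (simp add: case_prod_beta sum_distrib_left sum.swap [of _ "{..size m}"])
    also have "\<dots> = (\<Sum>k\<le>Suc (size m). mcoeff (h ^ k) m) - mcoeff (h ^ 0) m"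
      using sum.atMost_Suc_shift [of "\<lambda>k. mcoeff (h ^ k) m" "size m"] by simp
    also have "\<dots> = mcoeff (S - 1) m"
      by (subst S_eq [symmetric]) (auto simp: minus_mfps_def)
    finally show "mcoeff (h * S) m = mcoeff (S - 1) m" .
  qed
  then have "(1 - h) * S = 1" by (simp add: left_diff_distrib)
  then have "a * f * S = 1" by (simp add: h_def)
  then show ?thesis
    by (simp add: inverse_mfps_def Let_def a_def [symmetric] h_def [symmetric] S_def [symmetric] ac_simps)
qed


section \<open>Words, stack sorting and descents\<close>

definition r_permutation :: "nat \<Rightarrow> nat set \<Rightarrow> nat list \<Rightarrow> bool" where
  "r_permutation r A w \<longleftrightarrow>
     set w = A \<and> (\<forall>a\<in>A. count_list w a = r) \<and>
     (\<forall>i j k. i < j \<and> j < k \<and> k < length w \<and> w ! i = w ! k \<longrightarrow> w ! j \<le> w ! i)"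

definition tuple_r_permutation :: "nat \<Rightarrow> nat \<Rightarrow> nat \<Rightarrow> nat list list \<Rightarrow> bool" where
  "tuple_r_permutation r n k \<alpha> \<longleftrightarrow>
     length \<alpha> = k \<and> r_permutation r {1..n} (concat \<alpha>) \<and>
     (\<forall>i j. i < j \<and> j < k \<longrightarrow> set (\<alpha> ! i) \<inter> set (\<alpha> ! j) = {})"

text \<open>The (possibly empty) factors between consecutive occurrences of \<open>m\<close>.\<close>

fun split_word :: "nat \<Rightarrow> nat list \<Rightarrow> nat list list" where
  "split_word m [] = [[]]"
| "split_word m (x # xs) =
     (if x = m then [] # split_word m xs
      else (x # hd (split_word m xs)) # tl (split_word m xs))"

lemma split_word_nonempty: "split_word m w \<noteq> []"
  by (induction w) auto

lemma length_split_word_le: "\<alpha> \<in> set (split_word m w) \<Longrightarrow> length \<alpha> \<le> length w"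
proof (induction w arbitrary: \<alpha>)
  case (Cons x xs)
  have "hd (split_word m xs) \<in> set (split_word m xs)"
    by (simp add: split_word_nonempty)
  with Cons show ?case
    by (auto split: if_splits dest: list.set_sel(2) [OF split_word_nonempty] intro: le_SucI)
qed simp

lemma length_split_word_less:
  "m \<in> set w \<Longrightarrow> \<alpha> \<in> set (split_word m w) \<Longrightarrow> length \<alpha> < length w"
proof (induction w arbitrary: \<alpha>)
  case (Cons x xs)
  have "hd (split_word m xs) \<in> set (split_word m xs)"
    by (simp add: split_word_nonempty)
  with Cons show ?case
    by (auto split: if_splits dest: list.set_sel(2) [OF split_word_nonempty]
        simp: less_Suc_eq_le Suc_le_eq length_split_word_le)
qed simp

text \<open>Words with distinct letters are the case where the maximum occurs once, so that
  \<open>split_word\<close> returns exactly \<open>[\<pi>\<^sub>l, \<pi>\<^sub>r]\<close>.\<close>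

function stack_sort :: "nat list \<Rightarrow> nat list" where
  "stack_sort w =
     (if w = [] then []
      else concat (map stack_sort (split_word (Max (set w)) w)) @ [Max (set w)])"
  by auto
termination
  by (relation "measure length") (auto intro: length_split_word_less [OF Max_in])

declare stack_sort.simps [simp del]

definition two_stack_sortable :: "nat \<Rightarrow> nat list list \<Rightarrow> bool" where
  "two_stack_sortable n \<alpha> \<longleftrightarrow> stack_sort (concat (map stack_sort \<alpha>)) = [1..<Suc n]"

text \<open>For \<open>i \<ge> 1\<close>, position \<open>p\<close> holds the \<open>i\<close>th occurrence of \<open>w ! p\<close> iff
  the prefix of length \<open>p + 1\<close> contains that letter \<open>i\<close> times.\<close>

definition descents :: "nat \<Rightarrow> nat list \<Rightarrow> nat set" where
  "descents i w =
     (if i = 0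
      then {a. \<exists>p. Suc p < length w \<and> w ! Suc p = a \<and> a \<notin> set (take (Suc p) w) \<and> w ! p < a}
      else {a. \<exists>p. Suc p < length w \<and> w ! p = a \<and> count_list (take (Suc p) w) a = i \<and> w ! Suc p < a})"

definition tuple_descents :: "nat \<Rightarrow> nat list list \<Rightarrow> nat set" where
  "tuple_descents i \<alpha> = (\<Union>w\<in>set \<alpha>. descents i w)"


section \<open>Generating functions\<close>

text \<open>The indeterminates \<open>x\<^sub>0, \<dots>, x\<^sub>r\<close> are \<open>mvar 0, \<dots>, mvar r\<close>; the variable \<open>z\<close> is
  \<open>fps_X\<close> in the ring of univariate power series over \<open>xseries\<close>.\<close>

type_synonym xseries = "(nat, rat) mfps"

definition weight :: "nat \<Rightarrow> nat list list \<Rightarrow> xseries" where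
  "weight r \<alpha> = (\<Prod>i\<le>r. mvar i ^ card (tuple_descents i \<alpha>))"

definition g_nk :: "nat \<Rightarrow> nat \<Rightarrow> nat \<Rightarrow> xseries" where
  "g_nk r n k =
     (\<Sum>\<alpha> | tuple_r_permutation r n k \<alpha> \<and> (\<forall>w\<in>set \<alpha>. w \<noteq> []) \<and> two_stack_sortable n \<alpha>.
        weight r \<alpha>)"

text \<open>Coefficientwise sum over all \<open>n\<close>. A nonempty word with \<open>l\<close> distinct letters has
  \<open>l - 1\<close> descents in total (the type \<open>i\<close> descents are the nodes with a nonempty \<open>i\<close>th subtree
  in the associated \<open>(r+1)\<close>-ary tree), so \<open>g_nk r n k\<close> is homogeneous of degree \<open>n - k\<close> and only
  \<open>n = size m + k\<close> contributes to the coefficient at \<open>m\<close>.\<close>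

definition g_k :: "nat \<Rightarrow> nat \<Rightarrow> xseries" where
  "g_k r k = Abs_mfps (\<lambda>m. \<Sum>n | mcoeff (g_nk r n k) m \<noteq> 0. mcoeff (g_nk r n k) m)"

definition esym :: "nat \<Rightarrow> nat \<Rightarrow> xseries" where
  "esym r j = (\<Sum>I | I \<subseteq> {..r} \<and> card I = j. \<Prod>i\<in>I. mvar i)"

text \<open>The sum over all \<open>j\<close> stops at \<open>r + 1\<close> because \<open>esym r j = 0\<close> for \<open>j > r + 1\<close>.\<close>

definition f_k :: "nat \<Rightarrow> nat \<Rightarrow> xseries" where
  "f_k r k = (\<Sum>j\<le>Suc r. g_k r (k + j) * esym r j)"

definition G_series :: "nat \<Rightarrow> xseries fps" where
  "G_series r = Abs_fps (g_k r)"

definition F_series :: "nat \<Rightarrow> xseries fps" where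
  "F_series r = Abs_fps (f_k r)"


section \<open>The change of variables and the Catalan series\<close>

definition E_prod :: "nat \<Rightarrow> (nat \<Rightarrow> xseries) \<Rightarrow> xseries" where
  "E_prod r y = (\<Prod>i\<le>r. 1 + y i)"

definition E_prod_at :: "nat \<Rightarrow> (nat \<Rightarrow> xseries) \<Rightarrow> xseries fps \<Rightarrow> xseries fps" where
  "E_prod_at r y u = (\<Prod>i\<le>r. 1 + fps_const (y i) * u)"

text \<open>A tuple \<open>(y\<^sub>0, \<dots>, y\<^sub>r)\<close> is an extensional function on \<open>{..r}\<close>.\<close>

definition is_y :: "nat \<Rightarrow> (nat \<Rightarrow> xseries) \<Rightarrow> bool" where
  "is_y r y \<longleftrightarrow>
     y \<in> {..r} \<rightarrow>\<^sub>E {f. mvars_in {..r} f \<and> mcoeff f {#} = 0} \<and>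
     (\<forall>j\<le>r. mvar j = y j * (1 + y j) / (E_prod r y)\<^sup>2)"

text \<open>In \<open>catalan_fps\<close>, the square root of \<open>1 - 4 X\<close> is the one with constant term \<open>1\<close>.\<close>

definition catalan_fps :: "rat fps" where
  "catalan_fps = (1 - fps_radical (\<lambda>_ _. 1) 2 (1 - 4 * fps_X)) / (2 * fps_X)"

definition catalan_at :: "xseries fps \<Rightarrow> xseries fps" where
  "catalan_at t = Abs_fps (\<lambda>n. mconst (fps_nth catalan_fps n)) oo t"

text \<open>Division of univariate series: \<open>a / b\<close> is the exact quotient if the leading coefficient of
  \<open>b\<close> is a unit and \<open>subdegree b \<le> subdegree a\<close>, but it truncates negative powers otherwise. With
  \<open>t = z E(y)\<^sup>2\<close> the expression \<open>E(y) / t\<close> alone would be truncated to \<open>0\<close>, so in \<open>F\<close> the whole product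
  \<open>E(y) (E(y) - E(y, c) / c)\<close>, which has zero constant term in \<open>z\<close>, is divided by \<open>t\<close>.\<close>

end

theory Submission
  imports Defs "HOL-Library.Sublist"
begin

text \<open>Let \<open>n\<close> be the largest letter of a two-stack-sortable tuple, in the component
  \<open>\<beta>\<^sub>0 n \<beta>\<^sub>1 n \<dots> n \<beta>\<^sub>r\<close>. Since \<open>S\<close> moves \<open>n\<close> to the end of this component, the tuple is
  two-stack-sortable iff the components before it together with \<open>\<beta>\<^sub>0, \<dots>, \<beta>\<^sub>r\<close> form a
  two-stack-sortable tuple of some \<open>[c]\<close> and those after it one of the remaining letters;
  moreover \<open>n\<close> is a type \<open>i\<close> descent iff \<open>\<beta>\<^sub>i\<close> is nonempty. This gives \<open>G = 1 + z F G\<close>,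
  where \<open>F\<close> is the part of \<open>G \<cdot> \<Prod>\<^sub>i (1 + x\<^sub>i / z)\<close> with nonnegative powers of \<open>z\<close>, and the
  two equations determine \<open>G\<close> by recursion on the degree in \<open>x\<close>.

  For the closed form put \<open>p = 1 / c(t)\<close> and \<open>q = t c(t)\<close>, so \<open>p + q = 1\<close>, \<open>p q = t\<close> and
  \<open>E(y)\<^sup>2 (z + x\<^sub>i) = (p + y\<^sub>i) (q + y\<^sub>i)\<close>. Then \<open>G \<cdot> \<Prod>\<^sub>i (z + x\<^sub>i) - z\<^sup>r\<^sup>+\<^sup>1 F\<close> becomes, up to a
  factor free of \<open>z\<close>, a symmetric polynomial in \<open>p\<close> and \<open>q\<close>, hence a polynomial in \<open>z\<close>, and its
  degree is at most \<open>r\<close>.\<close>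

section \<open>Nested words and tuples of words with disjoint letters\<close>

abbreviation disj :: "nat list \<Rightarrow> nat list \<Rightarrow> bool" where
  "disj u v \<equiv> set u \<inter> set v = {}"

text \<open>Pattern form of the condition on positions in \<open>r_permutation\<close>: subsequences
  of a concatenation can be cut without index arithmetic.\<close>

definition nested :: "nat list \<Rightarrow> bool" where
  "nested w \<longleftrightarrow> (\<forall>a b. subseq [a, b, a] w \<longrightarrow> b \<le> a)"

text \<open>The letter set is left free, so that the factors of an r-permutation, including empty
  ones, are covered as well.\<close>

definition rword :: "nat \<Rightarrow> nat list \<Rightarrow> bool" where
  "rword r w \<longleftrightarrow> (\<forall>a\<in>set w. count_list w a = r) \<and> nested w"

definition valid :: "nat \<Rightarrow> nat list list \<Rightarrow> bool" where
  "valid r \<alpha> \<longleftrightarrow> (\<forall>w\<in>set \<alpha>. rword r w) \<and> sorted_wrt disj \<alpha>"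

definition stack_sort2 :: "nat list list \<Rightarrow> nat list" where
  "stack_sort2 \<alpha> = stack_sort (concat (map stack_sort \<alpha>))"

text \<open>The bridge between patterns and positions: fix where the first letter is matched and
  look for the rest behind it.\<close>

lemma subseq_Cons_nth:
  "subseq (a # xs) w \<longleftrightarrow> (\<exists>i<length w. w ! i = a \<and> subseq xs (drop (Suc i) w))"
proof (induction w)
  case (Cons x w)
  have "subseq (a # xs) (x # w) \<longleftrightarrow> x = a \<and> subseq xs w \<or> subseq (a # xs) w"
    by (auto dest: subseq_Cons')
  then show ?case
    by (simp add: Cons.IH Ex_less_Suc2)
qed simp

lemma nested_conv_nth:
  "nested w \<longleftrightarrow>
    (\<forall>i j k. i < j \<and> j < k \<and> k < length w \<and> w ! i = w ! k \<longrightarrow> w ! j \<le> w ! i)"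
proof
  assume L: "nested w"
  show "\<forall>i j k. i < j \<and> j < k \<and> k < length w \<and> w ! i = w ! k \<longrightarrow> w ! j \<le> w ! i"
  proof clarify
    fix i j k assume *: "i < j" "j < k" "k < length w" "w ! i = w ! k"
    have "w ! k \<in> set (drop (Suc j) w)"
      unfolding in_set_conv_nth using * by (intro exI[of _ "k - Suc j"]) auto
    then have "subseq [w ! j, w ! k] (drop (Suc i) w)"
      unfolding subseq_Cons_nth [of "w ! j"] using *
      by (intro exI[of _ "j - Suc i"]) (auto simp: subseq_singleton_left)
    then have "subseq [w ! i, w ! j, w ! i] w"
      unfolding subseq_Cons_nth [of "w ! i"] using * by (intro exI[of _ i]) auto
    then show "w ! j \<le> w ! i" using L by (auto simp: nested_def)
  qed
next
  assume R: "\<forall>i j k. i < j \<and> j < k \<and> k < length w \<and> w ! i = w ! k \<longrightarrow> w ! j \<le> w ! i"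
  show "nested w" unfolding nested_def
  proof (intro allI impI)
    fix a b assume "subseq [a, b, a] w"
    then obtain i j k where i: "i < length w" "w ! i = a" and j: "j < length (drop (Suc i) w)"
      "drop (Suc i) w ! j = b" and k: "k < length (drop (Suc j) (drop (Suc i) w))"
      "drop (Suc j) (drop (Suc i) w) ! k = a"
      by (auto simp: subseq_Cons_nth)
    show "b \<le> a"
      using R [rule_format, of i "Suc (i + j)" "Suc (Suc (i + j + k))"] i j k
      by (auto simp: add.commute add.left_commute)
  qed
qed

lemma subseq_triple_append:
  "subseq [a, b, c] (u @ v) \<longleftrightarrow> subseq [a, b, c] u \<or> subseq [a, b] u \<and> c \<in> set v \<or>
     a \<in> set u \<and> subseq [b, c] v \<or> subseq [a, b, c] v" (is "?L \<longleftrightarrow> ?R")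
proof -
  have "?L \<longleftrightarrow> (\<exists>xs1 xs2. [a, b, c] = xs1 @ xs2 \<and> subseq xs1 u \<and> subseq xs2 v)"
    by (rule subseq_append_iff)
  then have L: "?L \<longleftrightarrow> (\<exists>xs1 xs2. [a, b, c] = xs1 @ xs2 \<and> subseq xs1 u \<and> subseq xs2 v)" .
  have "?L \<Longrightarrow> ?R"
    unfolding L by (auto simp: Cons_eq_append_conv subseq_singleton_left)
  moreover have "?R \<Longrightarrow> ?L"
    using list_emb_append_mono [of "(=)" "[a, b]" u "[c]" v]
      list_emb_append_mono [of "(=)" "[a]" u "[b, c]" v]
    by (auto simp: subseq_singleton_left)
  ultimately show ?thesis by blast
qed

lemma subseq_set: "subseq xs w \<Longrightarrow> set xs \<subseteq> set w"
  by (auto elim: list_emb_set)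

text \<open>A pattern \<open>[a, b, a]\<close> across the border would put \<open>a\<close> in both
  words.\<close>

lemma nested_append:
  assumes "disj u v"
  shows "nested (u @ v) \<longleftrightarrow> nested u \<and> nested v"
proof -
  have "subseq [a, b, a] (u @ v) \<longleftrightarrow> subseq [a, b, a] u \<or> subseq [a, b, a] v" for a b
    using assms subseq_set [of "[a, b]" u] subseq_set [of "[b, a]" v]
    unfolding subseq_triple_append by auto
  then show ?thesis by (auto simp: nested_def)
qed

text \<open>A letter on both sides of \<open>M\<close> would enclose the larger \<open>M\<close>,
  which forces disjointness. Only \<open>u\<close> is required to stay strictly below
  \<open>M\<close>: in the induction over \<open>join_word\<close>, \<open>v\<close> contains the
  later copies of \<open>M\<close>.\<close>

lemma nested_append_max:
  assumes "\<forall>x\<in>set u. x < M" "\<forall>x\<in>set v. x \<le> M"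
  shows "nested (u @ M # v) \<longleftrightarrow> nested u \<and> nested v \<and> disj u v"
proof
  assume L: "nested (u @ M # v)"
  have "disj u v"
  proof (rule ccontr)
    assume "\<not> disj u v"
    then obtain a where a: "a \<in> set u" "a \<in> set v" by auto
    then have "subseq [a, M, a] (u @ M # v)"
      unfolding subseq_triple_append by (auto simp: subseq_singleton_left)
    then have "M \<le> a" using L unfolding nested_def by blast
    with a assms show False by auto
  qed
  moreover have "subseq u (u @ M # v)" "subseq v (u @ M # v)"
    by (auto simp: subseq_append_le_same_iff)
  ultimately show "nested u \<and> nested v \<and> disj u v"
    using L unfolding nested_def by (meson subseq_order.trans)
next
  assume R: "nested u \<and> nested v \<and> disj u v"
  show "nested (u @ M # v)" unfolding nested_def
  proof (intro allI impI)
    fix a b assume s: "subseq [a, b, a] (u @ M # v)"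
    have m: "a \<in> set (u @ M # v)" "b \<in> set (u @ M # v)" using subseq_set [OF s] by auto
    show "b \<le> a"
    proof (cases "a = M")
      case True then show ?thesis using m assms by auto
    next
      case False
      then have "subseq [a, b, a] u \<or> subseq [a, b, a] v"
        using s R subseq_set [of "[a, b]" u] subseq_set [of "[b, a]" "M # v"]
        unfolding subseq_triple_append by (auto simp: subseq_Cons2_neq)
      then show ?thesis using R by (auto simp: nested_def)
    qed
  qed
qed

lemma rword_append:
  assumes "disj u v"
  shows "rword r (u @ v) \<longleftrightarrow> rword r u \<and> rword r v"
proof -
  have "count_list u a = 0" if "a \<in> set v" for a
    using that assms by (auto simp: count_list_0_iff)
  moreover have "count_list v a = 0" if "a \<in> set u" for a
    using that assms by (auto simp: count_list_0_iff)
  ultimately have "(\<forall>a\<in>set (u @ v). count_list (u @ v) a = r) \<longleftrightarrow>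
      (\<forall>a\<in>set u. count_list u a = r) \<and> (\<forall>a\<in>set v. count_list v a = r)"
    by (simp add: ball_Un)
  then show ?thesis
    unfolding rword_def nested_append [OF assms] by blast
qed

lemma rword_concat:
  "sorted_wrt disj \<alpha> \<Longrightarrow> rword r (concat \<alpha>) \<longleftrightarrow> (\<forall>w\<in>set \<alpha>. rword r w)"
proof (induction \<alpha>)
  case (Cons u \<alpha>)
  then have "disj u (concat \<alpha>)" by auto
  with Cons show ?case by (simp add: rword_append)
qed (simp add: rword_def nested_def)

lemma valid_append:
  "valid r (\<alpha> @ \<beta>) \<longleftrightarrow> valid r \<alpha> \<and> valid r \<beta> \<and> disj (concat \<alpha>) (concat \<beta>)"
  unfolding valid_def sorted_wrt_append by auto

lemma valid_Cons:
  "valid r (u # \<beta>) \<longleftrightarrow> rword r u \<and> valid r \<beta> \<and> disj u (concat \<beta>)"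
  unfolding valid_def by auto

lemma valid_Nil_iff [simp]: "valid r ([] # \<beta>) \<longleftrightarrow> valid r \<beta>"
  unfolding valid_def by (auto simp: rword_def nested_def)

section \<open>Cutting words at their largest letter\<close>

text \<open>Inverse of \<open>split_word m\<close> on nonempty lists of words that avoid
  \<open>m\<close>.\<close>

fun join_word :: "nat \<Rightarrow> nat list list \<Rightarrow> nat list" where
  "join_word m [] = []"
| "join_word m [w] = w"
| "join_word m (w # v # ws) = w @ m # join_word m (v # ws)"

lemma set_join_word:
  "set (join_word m ws) = set (concat ws) \<union> (if length ws \<ge> 2 then {m} else {})"
  by (induction m ws rule: join_word.induct) auto

lemma count_join_word:
  "a \<noteq> m \<Longrightarrow> count_list (join_word m ws) a = count_list (concat ws) a"
  by (induction m ws rule: join_word.induct) auto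

lemma count_join_word_self:
  "m \<notin> set (concat ws) \<Longrightarrow> count_list (join_word m ws) m = length ws - 1"
  by (induction m ws rule: join_word.induct) (auto simp: count_list_0_iff)

lemma join_word_Cons_Cons: "join_word m ((x # w) # ws) = x # join_word m (w # ws)"
  by (cases ws) auto

lemma join_split_word: "join_word m (split_word m w) = w"
proof (induction w)
  case (Cons x w)
  obtain u us where u: "split_word m w = u # us"
    using split_word_nonempty list.exhaust by metis
  with Cons show ?case by (auto simp: join_word_Cons_Cons)
qed simp

lemma split_word_no_max: "u \<in> set (split_word m w) \<Longrightarrow> m \<notin> set u"
proof (induction w arbitrary: u)
  case (Cons x w)
  obtain v vs where "split_word m w = v # vs"
    using split_word_nonempty list.exhaust by metis
  with Cons show ?case by (auto split: if_splits)
qed simp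

lemma length_split_word: "length (split_word m w) = Suc (count_list w m)"
proof (induction w)
  case (Cons x w)
  obtain v vs where "split_word m w = v # vs"
    using split_word_nonempty list.exhaust by metis
  with Cons show ?case by auto
qed simp

lemma split_word_id: "m \<notin> set w \<Longrightarrow> split_word m w = [w]"
  by (induction w) auto

lemma split_word_append: "m \<notin> set u \<Longrightarrow> split_word m (u @ m # w) = u # split_word m w"
  by (induction u) auto

lemma split_join_word:
  "m \<notin> set (concat ws) \<Longrightarrow> ws \<noteq> [] \<Longrightarrow> split_word m (join_word m ws) = ws"
  by (induction m ws rule: join_word.induct) (auto simp: split_word_id split_word_append)

lemma set_stack_sort [simp]: "set (stack_sort w) = set w"
proof (induction w rule: stack_sort.induct)
  case (1 w)
  show ?case
  proof (cases "w = []")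
    case False
    let ?m = "Max (set w)"
    have m: "?m \<in> set w" using False by simp
    have "set w = set (join_word ?m (split_word ?m w))" by (simp add: join_split_word)
    also have "\<dots> = set (concat (split_word ?m w)) \<union> {?m}"
      using m count_list_0_iff [of w ?m]
      by (simp add: set_join_word length_split_word)
    finally show ?thesis using 1 False
      by (subst stack_sort.simps) auto
  qed (simp add: stack_sort.simps)
qed

lemma stack_sort_Nil [simp]: "stack_sort [] = []"
  by (simp add: stack_sort.simps)

text \<open>Two factors guarantee that \<open>m\<close> occurs, and the bound makes it the maximum,
  so \<open>stack_sort\<close> cuts the word into exactly \<open>ws\<close>.\<close>

lemma stack_sort_join_word:
  assumes "length ws \<ge> 2" "\<forall>x\<in>set (concat ws). x < m"
  shows "stack_sort (join_word m ws) = concat (map stack_sort ws) @ [m]"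
proof -
  let ?w = "join_word m ws"
  have s: "set ?w = insert m (set (concat ws))" using assms(1) by (simp add: set_join_word)
  have "Max (set ?w) = m" unfolding s using assms(2)
    by (intro Max_eqI) (auto intro: less_imp_le)
  moreover have "?w \<noteq> []" using s by auto
  moreover have "split_word m ?w = ws" using assms by (intro split_join_word) auto
  ultimately show ?thesis by (subst stack_sort.simps) simp
qed

lemma stack_sort_append_max:
  assumes "\<forall>x\<in>set u. x < m" "\<forall>x\<in>set v. x < m"
  shows "stack_sort (u @ m # v) = stack_sort u @ stack_sort v @ [m]"
  using stack_sort_join_word [of "[u, v]" m] assms by auto

lemma nested_join_word:
  assumes "\<forall>x\<in>set (concat ws). x < m"
  shows "nested (join_word m ws) \<longleftrightarrow> (\<forall>w\<in>set ws. nested w) \<and> sorted_wrt disj ws"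
  using assms
proof (induction m ws rule: join_word.induct)
  case (3 m w v ws)
  have "\<forall>x\<in>set (join_word m (v # ws)). x \<le> m"
    using 3 by (auto simp: set_join_word less_imp_le)
  with 3 have "nested (join_word m (w # v # ws)) \<longleftrightarrow>
     nested w \<and> nested (join_word m (v # ws)) \<and> disj w (join_word m (v # ws))"
    by (simp add: nested_append_max)
  moreover have "disj w (join_word m (v # ws)) \<longleftrightarrow> (\<forall>u\<in>set (v # ws). disj w u)"
    using 3 by (auto simp: set_join_word)
  ultimately show ?case using 3 by auto
qed (auto simp: nested_def)

text \<open>Between \<open>r + 1\<close> factors stand \<open>r\<close> copies of \<open>m\<close>,
  and all other letters are counted as in the concatenation. If the factors share a letter, both
  sides fail.\<close>

lemma rword_join_word:
  assumes "\<forall>x\<in>set (concat ws). x < m" "length ws = Suc r" "r \<ge> 1"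
  shows "rword r (join_word m ws) \<longleftrightarrow> valid r ws"
proof (cases "sorted_wrt disj ws")
  case True
  have "(\<forall>a\<in>set (join_word m ws). count_list (join_word m ws) a = r) \<longleftrightarrow>
      (\<forall>a\<in>set (concat ws). count_list (concat ws) a = r)"
  proof -
    have "set (join_word m ws) = insert m (set (concat ws))"
      using assms by (simp add: set_join_word)
    moreover have "count_list (join_word m ws) m = r"
      using assms by (subst count_join_word_self) auto
    moreover have "count_list (join_word m ws) a = count_list (concat ws) a"
      if "a \<in> set (concat ws)" for a
      using that assms by (intro count_join_word) auto
    ultimately show ?thesis by (simp only: ball_simps) auto
  qed
  moreover have "nested (concat ws) \<longleftrightarrow> (\<forall>w\<in>set ws. nested w)"
    using True
  proof (induction ws)
    case (Cons w ws)
    then have "disj w (concat ws)" by auto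
    with Cons show ?case by (simp add: nested_append)
  qed (simp add: nested_def)
  ultimately have "rword r (join_word m ws) \<longleftrightarrow> rword r (concat ws)"
    unfolding rword_def nested_join_word [OF assms(1)] using True by simp
  then show ?thesis using True by (simp add: rword_concat valid_def)
next
  case False
  then show ?thesis using nested_join_word [OF assms(1)] by (auto simp: rword_def valid_def)
qed

section \<open>Descents and weights\<close>

lemma descents_Nil [simp]: "descents i [] = {}"
  by (simp add: descents_def)

lemma descents_subset: "descents i w \<subseteq> set w"
  by (auto simp: descents_def)

lemma ex_nat_0_Suc: "(\<exists>p. P p) \<longleftrightarrow> P 0 \<or> (\<exists>p. P (Suc p))"
  by (metis not0_implies_Suc)

text \<open>Recursive form for inductions on the word. A leading \<open>a\<close> is itself the
  first occurrence and follows nothing, so it rules out a type 0 descent at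
  \<open>a\<close>.\<close>

lemma mem_descents_0_Cons:
  "a \<in> descents 0 (x # w) \<longleftrightarrow>
     x \<noteq> a \<and> (w \<noteq> [] \<and> hd w = a \<and> x < a \<or> a \<in> descents 0 w)"
proof -
  have "a \<in> descents 0 (x # w) \<longleftrightarrow> (\<exists>p. p < length w \<and> w ! p = a \<and>
      a \<notin> set (x # take p w) \<and> (x # w) ! p < a)"
    by (simp add: descents_def)
  also have "\<dots> \<longleftrightarrow> (w \<noteq> [] \<and> hd w = a \<and> x \<noteq> a \<and> x < a) \<or>
      (\<exists>p. Suc p < length w \<and> w ! Suc p = a \<and> a \<notin> set (x # take (Suc p) w) \<and> w ! p < a)"
    by (subst ex_nat_0_Suc) (auto simp: hd_conv_nth)
  also have "\<dots> \<longleftrightarrow> x \<noteq> a \<and> (w \<noteq> [] \<and> hd w = a \<and> x < a \<or> a \<in> descents 0 w)"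
    by (auto simp: descents_def)
  finally show ?thesis .
qed

text \<open>A leading \<open>a\<close> raises the index of each later occurrence of \<open>a\<close>
  by one. Index 1 is separate: there the leading letter itself is the relevant occurrence, and
  \<open>descents 0\<close> has another meaning.\<close>

lemma mem_descents_Suc_Cons:
  "a \<in> descents (Suc i) (x # w) \<longleftrightarrow>
     (if x = a then (if i = 0 then w \<noteq> [] \<and> hd w < a else a \<in> descents i w)
      else a \<in> descents (Suc i) w)"
proof -
  \<comment> \<open>The letter at position \<open>p\<close> is counted in the prefix ending there;
    hence for \<open>x = a\<close> and \<open>i = 0\<close> no position of the tail
    qualifies.\<close>
  have *: "count_list (take (Suc p) w) (w ! p) \<noteq> 0" if "p < length w" for p
    using that by (auto simp: count_list_0_iff take_Suc_conv_app_nth)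
  have "a \<in> descents (Suc i) (x # w) \<longleftrightarrow> (\<exists>p. p < length w \<and> (x # w) ! p = a \<and>
      count_list (x # take p w) a = Suc i \<and> w ! p < a)"
    by (simp add: descents_def)
  also have "\<dots> \<longleftrightarrow> (w \<noteq> [] \<and> x = a \<and> i = 0 \<and> hd w < a) \<or>
      (\<exists>p. Suc p < length w \<and> w ! p = a \<and> count_list (x # take (Suc p) w) a = Suc i \<and> w ! Suc p < a)"
    by (subst ex_nat_0_Suc) (auto simp: hd_conv_nth)
  also have "\<dots> \<longleftrightarrow> (if x = a then (if i = 0 then w \<noteq> [] \<and> hd w < a else a \<in> descents i w)
      else a \<in> descents (Suc i) w)"
    by (auto simp: descents_def *)
  finally show ?thesis .
qed

text \<open>An \<open>a\<close> directly after \<open>m\<close> follows a larger letter, so the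
  border creates no type 0 descent at \<open>a\<close>.\<close>

lemma descents_append_max_right:
  assumes "a \<notin> set u" "a \<noteq> m" "a \<in> set v \<Longrightarrow> a \<le> m"
  shows "a \<in> descents i (u @ m # v) \<longleftrightarrow> a \<in> descents i v"
  using assms
proof (induction u)
  case Nil
  then show ?case using descents_subset [of 0 v] hd_in_set [of v]
    by (cases i) (auto simp: mem_descents_0_Cons mem_descents_Suc_Cons)
next
  case (Cons x u)
  then show ?case
    by (cases i; cases u) (auto simp: mem_descents_0_Cons mem_descents_Suc_Cons)
qed

text \<open>An \<open>a\<close> directly before \<open>m\<close> is followed by a larger letter, so
  the border creates no descent of positive type at \<open>a\<close>.\<close>

lemma descents_append_max_left:
  assumes "a \<notin> set v" "a < m"
  shows "a \<in> descents i (u @ m # v) \<longleftrightarrow> a \<in> descents i u"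
  using assms
proof (induction u arbitrary: i)
  case Nil
  then show ?case using descents_subset [of i "m # v"] by auto
next
  case (Cons x u)
  then show ?case
    by (cases i) (auto simp: mem_descents_0_Cons mem_descents_Suc_Cons hd_append)
qed

text \<open>The displayed \<open>m\<close> is the first occurrence and decides types 0 and 1; for
  higher types the occurrences in \<open>v\<close> count, with index lowered by one.\<close>

lemma max_mem_descents:
  assumes "\<forall>x\<in>set u. x < m"
  shows "m \<in> descents i (u @ m # v) \<longleftrightarrow>
    (if i = 0 then u \<noteq> [] else if i = 1 then v \<noteq> [] \<and> hd v < m else m \<in> descents (i - 1) v)"
  using assms
proof (induction u)
  case Nil
  then show ?case
    by (cases i) (auto simp: mem_descents_0_Cons mem_descents_Suc_Cons)
next
  case (Cons x u)
  then show ?case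
    by (cases i; cases u) (auto simp: mem_descents_0_Cons mem_descents_Suc_Cons)
qed

text \<open>With factors numbered from 0, the \<open>i\<close>th copy of \<open>m\<close> is
  directly followed by factor \<open>i\<close> and the first copy is directly preceded by factor 0,
  which explains the single criterion \<open>ws ! i \<noteq> []\<close>. Any other letter has all
  its occurrences in one factor.\<close>

lemma descents_join_word:
  assumes "\<forall>x\<in>set (concat ws). x < m" "sorted_wrt disj ws"
  shows "descents i (join_word m ws) =
    (\<Union>w\<in>set ws. descents i w) \<union> (if length ws \<ge> 2 \<and> i < length ws \<and> ws ! i \<noteq> [] then {m} else {})"
  using assms
proof (induction m ws arbitrary: i rule: join_word.induct)
  case (3 m w v ws)
  let ?J = "join_word m (v # ws)"
  have J: "\<forall>x\<in>set ?J. x \<le> m" "disj w ?J" "\<forall>x\<in>set w. x < m"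
    using 3 by (auto simp: set_join_word less_imp_le)
  have IH: "descents i ?J = (\<Union>w\<in>set (v # ws). descents i w) \<union>
      (if length (v # ws) \<ge> 2 \<and> i < length (v # ws) \<and> (v # ws) ! i \<noteq> [] then {m} else {})" for i
    using 3 by simp
  have nm: "m \<notin> descents i u" if "u \<in> set (w # v # ws)" for u i
    using that 3(2) descents_subset [of i u] by auto
  have "a \<in> descents i (w @ m # ?J) \<longleftrightarrow> a \<in> (\<Union>w\<in>set (w # v # ws). descents i w)"
    if "a \<noteq> m" for a
  proof (cases "a \<in> set w")
    case True
    then have "a \<notin> set ?J" "a < m" using J by auto
    then show ?thesis using descents_append_max_left [of a ?J m i w]
        descents_subset [of i ?J] IH [of i] that by auto
  next
    case False
    then show ?thesis using descents_append_max_right [of a w m ?J i] J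
        descents_subset [of i w] IH [of i] that by auto
  qed
  moreover have "m \<in> descents i (w @ m # ?J) \<longleftrightarrow> i < length (w # v # ws) \<and> (w # v # ws) ! i \<noteq> []"
  proof -
    \<comment> \<open>If \<open>v\<close> is empty, the first \<open>m\<close> is followed by
      nothing or by the next copy of \<open>m\<close>, so it is no descent.\<close>
    have "?J \<noteq> [] \<and> hd ?J < m \<longleftrightarrow> v \<noteq> []"
      using 3(2) by (cases ws; cases v) auto
    moreover have "m \<in> descents (i - 1) ?J \<longleftrightarrow> i < length (w # v # ws) \<and> (w # v # ws) ! i \<noteq> []"
      if "i > 1"
      using that nm unfolding IH by (cases i) auto
    ultimately show ?thesis using J(3) by (subst max_mem_descents) (cases i; auto)+
  qed
  moreover have "m \<notin> (\<Union>w\<in>set (w # v # ws). descents i w)" using nm by blast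
  ultimately have "a \<in> descents i (w @ m # ?J) \<longleftrightarrow> a \<in> (\<Union>w\<in>set (w # v # ws). descents i w) \<union>
      (if i < length (w # v # ws) \<and> (w # v # ws) ! i \<noteq> [] then {m} else {})" for a
    by (cases "a = m") (simp_all only: Un_iff split: if_split, blast+)
  then show ?case by auto
qed auto

lemma finite_tuple_descents: "finite (tuple_descents i \<alpha>)"
  by (auto simp: tuple_descents_def intro: finite_subset [OF descents_subset])

lemma tuple_descents_subset: "tuple_descents i \<alpha> \<subseteq> set (concat \<alpha>)"
  using descents_subset by (auto simp: tuple_descents_def)

lemma tuple_descents_Nil_word [simp]: "tuple_descents i (\<gamma> @ [] # \<beta>) = tuple_descents i (\<gamma> @ \<beta>)"
  by (auto simp: tuple_descents_def)

text \<open>The contribution of the descents at the largest letter. The offset \<open>j\<close>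
  allows the factors to be consumed from the front.\<close>

definition fill_weight :: "nat \<Rightarrow> nat list list \<Rightarrow> xseries" where
  "fill_weight j ws = (\<Prod>i<length ws. if ws ! i = [] then 1 else mvar (i + j))"

lemma fill_weight_Nil [simp]: "fill_weight j [] = 1"
  by (simp add: fill_weight_def)

lemma fill_weight_Cons [simp]:
  "fill_weight j (w # ws) = (if w = [] then 1 else mvar j) * fill_weight (Suc j) ws"
  by (simp add: fill_weight_def prod.lessThan_Suc_shift del: prod.lessThan_Suc cong: if_cong)

text \<open>Joining adds only descents at \<open>m\<close>. The descents of the remaining groups lie
  in disjoint letter sets, so the cardinalities add up and the weights multiply.\<close>

lemma weight_append_join_word:
  assumes "valid r (\<gamma> @ \<beta> @ \<delta>)" "\<forall>x\<in>set (concat \<beta>). x < m" "m \<notin> set (concat (\<gamma> @ \<delta>))"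
    "length \<beta> = Suc r" "r \<ge> 1"
  shows "weight r (\<gamma> @ [join_word m \<beta>] @ \<delta>) =
    weight r (\<gamma> @ \<beta>) * fill_weight 0 \<beta> * weight r \<delta>"
proof -
  have "card (tuple_descents i (\<gamma> @ [join_word m \<beta>] @ \<delta>)) =
      card (tuple_descents i (\<gamma> @ \<beta>)) + (if \<beta> ! i = [] then 0 else 1) + card (tuple_descents i \<delta>)"
    if "i \<le> r" for i
  proof -
    let ?M = "if \<beta> ! i = [] then {} else {m}"
    have "sorted_wrt disj \<beta>" using assms(1) by (simp add: valid_def sorted_wrt_append)
    then have "tuple_descents i (\<gamma> @ [join_word m \<beta>] @ \<delta>) =
        (tuple_descents i (\<gamma> @ \<beta>) \<union> ?M) \<union> tuple_descents i \<delta>"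
      using assms(2-) that by (auto simp: tuple_descents_def descents_join_word)
    moreover have "m \<notin> tuple_descents i (\<gamma> @ \<beta>)" "m \<notin> tuple_descents i \<delta>"
      using assms(2,3) tuple_descents_subset [of i "\<gamma> @ \<beta>"] tuple_descents_subset [of i \<delta>]
      by (auto dest!: subsetD)
    moreover have "tuple_descents i (\<gamma> @ \<beta>) \<inter> tuple_descents i \<delta> = {}"
      using assms(1) tuple_descents_subset [of i "\<gamma> @ \<beta>"] tuple_descents_subset [of i \<delta>]
      by (simp only: append_assoc [symmetric] valid_append [of _ "\<gamma> @ \<beta>"]) blast
    ultimately show ?thesis
      by (simp add: card_Un_disjoint finite_tuple_descents)
  qed
  moreover have "fill_weight 0 \<beta> = (\<Prod>i\<le>r. mvar i ^ (if \<beta> ! i = [] then 0 else 1))"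
    unfolding fill_weight_def assms(4) lessThan_Suc_atMost by (intro prod.cong) auto
  ultimately show ?thesis
    by (simp add: weight_def power_add prod.distrib)
qed

section \<open>Removing the largest letter of a tuple\<close>

text \<open>The letters form an arbitrary interval because the components after the largest letter
  use a final segment of the alphabet, which does not start at 1 in general.\<close>

definition sortable_tuples :: "nat \<Rightarrow> nat \<Rightarrow> nat \<Rightarrow> nat \<Rightarrow> nat list list set" where
  "sortable_tuples r a b k =
     {\<alpha>. length \<alpha> = k \<and> [] \<notin> set \<alpha> \<and> valid r \<alpha> \<and> stack_sort2 \<alpha> = [a..<b]}"

text \<open>\<open>\<gamma>\<close> is the part of a tuple before the component containing the largest letter, and \<open>\<beta>\<close> the
  list of the factors of that component, which may be empty.\<close>

definition mixed_tuples :: "nat \<Rightarrow> nat \<Rightarrow> nat \<Rightarrow> nat \<Rightarrow> nat \<Rightarrow> (nat list list \<times> nat list list) set" where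
  "mixed_tuples r a b i s =
     {(\<gamma>, \<beta>). length \<gamma> = i \<and> [] \<notin> set \<gamma> \<and> length \<beta> = s \<and> valid r (\<gamma> @ \<beta>) \<and>
        stack_sort2 (\<gamma> @ \<beta>) = [a..<b]}"

text \<open>Sorting preserves the letter set, so sortability already forces the letters to be
  \<open>{1..n}\<close>.\<close>

lemma tuple_r_permutation_iff_valid:
  "tuple_r_permutation r n k \<alpha> \<and> two_stack_sortable n \<alpha> \<longleftrightarrow>
     length \<alpha> = k \<and> valid r \<alpha> \<and> stack_sort2 \<alpha> = [1..<Suc n]" (is "?L \<longleftrightarrow> ?R")
proof -
  have r: "r_permutation r A w \<longleftrightarrow> set w = A \<and> rword r w" for A w
    by (auto simp: r_permutation_def rword_def nested_conv_nth)
  have s: "set (concat \<alpha>) = {1..n}" if "stack_sort2 \<alpha> = [1..<Suc n]"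
  proof -
    have "set (concat \<alpha>) = set (stack_sort2 \<alpha>)" by (auto simp: stack_sort2_def)
    then show ?thesis using that by auto
  qed
  have d: "(\<forall>i j. i < j \<and> j < k \<longrightarrow> disj (\<alpha> ! i) (\<alpha> ! j)) \<longleftrightarrow> sorted_wrt disj \<alpha>" if "length \<alpha> = k"
    using that by (auto simp: sorted_wrt_iff_nth_less)
  have "?L \<longleftrightarrow> length \<alpha> = k \<and> rword r (concat \<alpha>) \<and> sorted_wrt disj \<alpha> \<and> stack_sort2 \<alpha> = [1..<Suc n]"
    unfolding tuple_r_permutation_def two_stack_sortable_def stack_sort2_def [symmetric] r
    using s d by blast
  also have "\<dots> \<longleftrightarrow> ?R"
    unfolding valid_def using rword_concat by blast
  finally show ?thesis .
qed

lemma set_stack_sort2: "set (stack_sort2 \<alpha>) = set (concat \<alpha>)"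
  by (auto simp: stack_sort2_def)

lemma g_nk_eq: "g_nk r n k = (\<Sum>\<alpha>\<in>sortable_tuples r 1 (Suc n) k. weight r \<alpha>)"
  unfolding g_nk_def sortable_tuples_def
proof (rule sum.cong)
  show "{\<alpha>. tuple_r_permutation r n k \<alpha> \<and> (\<forall>w\<in>set \<alpha>. w \<noteq> []) \<and> two_stack_sortable n \<alpha>} =
      {\<alpha>. length \<alpha> = k \<and> [] \<notin> set \<alpha> \<and> valid r \<alpha> \<and> stack_sort2 \<alpha> = [1..<Suc n]}"
    using tuple_r_permutation_iff_valid [of r n k] by blast
qed simp

text \<open>Each letter occurs \<open>r\<close> times. This bound on the length is what makes the
  index sets of all sums finite.\<close>

lemma length_valid:
  assumes "valid r \<alpha>" "set (concat \<alpha>) \<subseteq> {a..<b}"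
  shows "length (concat \<alpha>) \<le> r * (b - a)"
proof -
  have "rword r (concat \<alpha>)" using assms by (simp add: valid_def rword_concat)
  then have "length (concat \<alpha>) = r * card (set (concat \<alpha>))"
    using sum_count_set [of "concat \<alpha>" "set (concat \<alpha>)"]
      sum.cong [of "set (concat \<alpha>)" "set (concat \<alpha>)" "count_list (concat \<alpha>)" "\<lambda>_. r"]
    unfolding rword_def by (simp del: set_concat add: mult.commute)
  then show ?thesis using card_mono [OF _ assms(2)] by simp
qed

lemma finite_valid:
  "finite {\<alpha>. length \<alpha> = k \<and> valid r \<alpha> \<and> stack_sort2 \<alpha> = [a..<b]}" (is "finite ?T")
proof -
  let ?W = "{w. set w \<subseteq> {a..<b} \<and> length w \<le> r * (b - a)}"
  have "?T \<subseteq> {\<alpha>. set \<alpha> \<subseteq> ?W \<and> length \<alpha> = k}"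
  proof (intro subsetI CollectI conjI)
    fix \<alpha> w assume "\<alpha> \<in> ?T" and w: "w \<in> set \<alpha>"
    then have \<alpha>: "valid r \<alpha>" "stack_sort2 \<alpha> = [a..<b]" by auto
    have s: "set (concat \<alpha>) = {a..<b}" using set_stack_sort2 [of \<alpha>] \<alpha>(2) by simp
    have "length w \<le> length (concat \<alpha>)"
      using w by (simp add: length_concat member_le_sum_list)
    then show "length w \<le> r * (b - a)"
      using s length_valid [OF \<alpha>(1), of a b] by simp
    fix x assume "x \<in> set w"
    then show "x \<in> {a..<b}" using s w by auto
  qed auto
  then show ?thesis
    by (rule finite_subset) (intro finite_lists_length_eq finite_lists_length_le finite_atLeastLessThan)
qed

lemma finite_sortable_tuples: "finite (sortable_tuples r a b k)"
  unfolding sortable_tuples_def by (rule finite_subset [OF _ finite_valid [of k r a b]]) blast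

lemma finite_mixed_tuples: "finite (mixed_tuples r a b i s)"
proof (rule finite_subset)
  let ?T = "{\<alpha>. length \<alpha> = i + s \<and> valid r \<alpha> \<and> stack_sort2 \<alpha> = [a..<b]}"
  show "mixed_tuples r a b i s \<subseteq> (\<lambda>\<alpha>. (take i \<alpha>, drop i \<alpha>)) ` ?T"
  proof clarify
    fix \<gamma> \<beta> assume "(\<gamma>, \<beta>) \<in> mixed_tuples r a b i s"
    then show "(\<gamma>, \<beta>) \<in> (\<lambda>\<alpha>. (take i \<alpha>, drop i \<alpha>)) ` ?T"
      by (intro image_eqI [of _ _ "\<gamma> @ \<beta>"]) (auto simp: mixed_tuples_def)
  qed
  show "finite ((\<lambda>\<alpha>. (take i \<alpha>, drop i \<alpha>)) ` ?T)"
    by (rule finite_imageI [OF finite_valid])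
qed

lemma sum_mixed_tuples_0:
  "(\<Sum>(\<gamma>, \<beta>)\<in>mixed_tuples r a b i 0. weight r (\<gamma> @ \<beta>) * fill_weight j \<beta>) =
     (\<Sum>\<alpha>\<in>sortable_tuples r a b i. weight r \<alpha>)"
  by (rule sum.reindex_bij_witness [where i = "\<lambda>\<alpha>. (\<alpha>, [])" and j = fst])
    (auto simp: mixed_tuples_def sortable_tuples_def)

lemma weight_Nil_word [simp]: "weight r (\<gamma> @ [] # \<beta>) = weight r (\<gamma> @ \<beta>)"
  by (simp add: weight_def)

lemma valid_Nil_word [simp]: "valid r (\<gamma> @ [] # \<beta>) \<longleftrightarrow> valid r (\<gamma> @ \<beta>)"
  by (simp add: valid_append)

lemma stack_sort2_Nil_word [simp]: "stack_sort2 (\<gamma> @ [] # \<beta>) = stack_sort2 (\<gamma> @ \<beta>)"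
  by (simp add: stack_sort2_def)

lemma sum_mixed_tuples_Suc:
  "(\<Sum>(\<gamma>, \<beta>)\<in>mixed_tuples r a b i (Suc s). weight r (\<gamma> @ \<beta>) * fill_weight j \<beta>) =
     (\<Sum>(\<gamma>, \<beta>)\<in>mixed_tuples r a b i s. weight r (\<gamma> @ \<beta>) * fill_weight (Suc j) \<beta>) +
     mvar j * (\<Sum>(\<gamma>, \<beta>)\<in>mixed_tuples r a b (Suc i) s. weight r (\<gamma> @ \<beta>) * fill_weight (Suc j) \<beta>)"
    (is "?L = ?A + _ * ?B")
proof -
  let ?f = "\<lambda>(\<gamma>, \<beta>). weight r (\<gamma> @ \<beta>) * fill_weight j \<beta>"
  let ?M = "mixed_tuples r a b i (Suc s)"
  let ?E = "{p \<in> ?M. hd (snd p) = []}"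
  have fin: "finite ?M" by (rule finite_mixed_tuples)
  have "?L = sum ?f ?E + sum ?f (?M - ?E)"
    using sum.subset_diff [of ?E ?M ?f] fin by (simp add: add.commute)
  moreover have "sum ?f ?E = ?A"
    by (rule sum.reindex_bij_witness
        [where i = "\<lambda>(\<gamma>, \<beta>). (\<gamma>, [] # \<beta>)" and j = "\<lambda>(\<gamma>, \<beta>). (\<gamma>, tl \<beta>)"])
      (auto simp: mixed_tuples_def length_Suc_conv)
  moreover have "sum ?f (?M - ?E) = mvar j * ?B"
    unfolding sum_distrib_left
  proof (rule sum.reindex_bij_witness
        [where i = "\<lambda>(\<gamma>, \<beta>). (butlast \<gamma>, last \<gamma> # \<beta>)" and j = "\<lambda>(\<gamma>, \<beta>). (\<gamma> @ [hd \<beta>], tl \<beta>)"])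
    fix p assume "p \<in> ?M - ?E"
    then obtain \<gamma> w ws where p: "p = (\<gamma>, w # ws)" "w \<noteq> []"
        "(\<gamma> @ [w], ws) \<in> mixed_tuples r a b (Suc i) s"
      by (cases p; cases "snd p") (auto simp: mixed_tuples_def)
    then show "(case case p of (\<gamma>, \<beta>) \<Rightarrow> (\<gamma> @ [hd \<beta>], tl \<beta>) of (\<gamma>, \<beta>) \<Rightarrow> (butlast \<gamma>, last \<gamma> # \<beta>)) = p"
      "(case p of (\<gamma>, \<beta>) \<Rightarrow> (\<gamma> @ [hd \<beta>], tl \<beta>)) \<in> mixed_tuples r a b (Suc i) s"
      "mvar j * (case case p of (\<gamma>, \<beta>) \<Rightarrow> (\<gamma> @ [hd \<beta>], tl \<beta>) of
          (\<gamma>, \<beta>) \<Rightarrow> weight r (\<gamma> @ \<beta>) * fill_weight (Suc j) \<beta>) =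
        (case p of (\<gamma>, \<beta>) \<Rightarrow> weight r (\<gamma> @ \<beta>) * fill_weight j \<beta>)"
      by (simp_all add: mult.left_commute)
  next
    fix p assume "p \<in> mixed_tuples r a b (Suc i) s"
    moreover obtain \<gamma> \<beta> where p: "p = (\<gamma>, \<beta>)" by fastforce
    ultimately obtain \<gamma>' w where "\<gamma> = \<gamma>' @ [w]" "(\<gamma>', w # \<beta>) \<in> ?M - ?E"
      by (cases \<gamma> rule: rev_cases) (auto simp: mixed_tuples_def)
    then show "(case case p of (\<gamma>, \<beta>) \<Rightarrow> (butlast \<gamma>, last \<gamma> # \<beta>) of (\<gamma>, \<beta>) \<Rightarrow> (\<gamma> @ [hd \<beta>], tl \<beta>)) = p"
      "(case p of (\<gamma>, \<beta>) \<Rightarrow> (butlast \<gamma>, last \<gamma> # \<beta>)) \<in> ?M - ?E"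
      by (simp_all add: p)
  qed
  ultimately show ?thesis by simp
qed

text \<open>\<open>I\<close> is the set of indices, shifted by \<open>j\<close>, of the nonempty
  factors; these become ordinary components of the tuple.\<close>

lemma sum_mixed_tuples:
  "(\<Sum>(\<gamma>, \<beta>)\<in>mixed_tuples r a b i s. weight r (\<gamma> @ \<beta>) * fill_weight j \<beta>) =
     (\<Sum>I\<in>Pow {j..<j + s}. (\<Prod>v\<in>I. mvar v) * (\<Sum>\<alpha>\<in>sortable_tuples r a b (i + card I). weight r \<alpha>))"
proof (induction s arbitrary: i j)
  case 0
  then show ?case by (simp add: sum_mixed_tuples_0)
next
  case (Suc s)
  let ?J = "{Suc j..<Suc j + s}"
  let ?h = "\<lambda>i I. (\<Prod>v\<in>I. mvar v) * (\<Sum>\<alpha>\<in>sortable_tuples r a b (i + card I). weight r \<alpha>)"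
  have J: "{j..<j + Suc s} = insert j ?J" by auto
  have "sum (?h i) (Pow (insert j ?J)) = sum (?h i) (Pow ?J) + sum (?h i) (insert j ` Pow ?J)"
    unfolding Pow_insert by (intro sum.union_disjoint) auto
  also have "sum (?h i) (insert j ` Pow ?J) = (\<Sum>I\<in>Pow ?J. ?h i (insert j I))"
  proof (subst sum.reindex)
    show "inj_on (insert j) (Pow ?J)"
    proof (rule inj_onI)
      fix A B assume "A \<in> Pow ?J" "B \<in> Pow ?J" "insert j A = insert j B"
      moreover from this have "j \<notin> A" "j \<notin> B" by auto
      ultimately show "A = B" by (simp add: insert_ident)
    qed
  qed simp
  also have "\<dots> = (\<Sum>I\<in>Pow ?J. mvar j * ?h (Suc i) I)"
  proof (rule sum.cong)
    fix I assume I: "I \<in> Pow ?J"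
    then have "finite I" "j \<notin> I" by (auto intro: finite_subset)
    then show "?h i (insert j I) = mvar j * ?h (Suc i) I" by (simp add: mult.assoc)
  qed simp
  finally show ?case
    unfolding J sum_mixed_tuples_Suc Suc.IH by (simp add: sum_distrib_left)
qed

text \<open>The first sorting pass moves \<open>m\<close> to the end of its component, so afterwards
  a single \<open>m\<close> separates the letters of \<open>\<gamma>\<close> and
  \<open>\<beta>\<close> from those of \<open>\<delta>\<close>, and the second pass sorts the two
  sides independently.\<close>

lemma stack_sort2_remove_max:
  assumes "\<forall>x\<in>set (concat (\<gamma> @ \<beta> @ \<delta>)). x < m" "length \<beta> \<ge> 2"
  shows "stack_sort2 (\<gamma> @ [join_word m \<beta>] @ \<delta>) = stack_sort2 (\<gamma> @ \<beta>) @ stack_sort2 \<delta> @ [m]"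
proof -
  have "stack_sort2 (\<gamma> @ [join_word m \<beta>] @ \<delta>) =
    stack_sort (concat (map stack_sort (\<gamma> @ \<beta>)) @ m # concat (map stack_sort \<delta>))"
    using assms by (simp add: stack_sort2_def stack_sort_join_word)
  also have "\<dots> = stack_sort2 (\<gamma> @ \<beta>) @ stack_sort2 \<delta> @ [m]"
    using assms(1) unfolding stack_sort2_def by (intro stack_sort_append_max) auto
  finally show ?thesis .
qed

lemma append_eq_upt:
  assumes "a \<le> b" "u @ v = [a..<b]"
  shows "u = [a..<a + length u]" "v = [a + length u..<b]" "a + length u \<le> b"
proof -
  have l: "length u \<le> b - a" using arg_cong [OF assms(2), of length] by simp
  then show "a + length u \<le> b" using assms(1) by simp
  then have "u = take (length u) [a..<b]" "v = drop (length u) [a..<b]"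
    using assms(2) append_eq_conv_conj [of u v] by metis+
  with l show "u = [a..<a + length u]" "v = [a + length u..<b]"
    using assms(1) by (simp_all only: take_upt drop_upt \<open>a + length u \<le> b\<close>)
qed

text \<open>The pieces sort to the adjacent intervals \<open>[a..<c]\<close> and
  \<open>[c..<b]\<close>, to which \<open>b\<close> is appended. The last three facts identify the
  joined component as the first one containing \<open>b\<close>, from which the pieces can be
  recovered.\<close>

lemma remove_max_join:
  assumes "(\<gamma>, \<beta>) \<in> mixed_tuples r a c i (Suc r)" "\<delta> \<in> sortable_tuples r c b k"
    "a \<le> c" "c \<le> b" "r \<ge> 1"
  shows "\<gamma> @ [join_word b \<beta>] @ \<delta> \<in> sortable_tuples r a (Suc b) (Suc (i + k))"
    and "weight r (\<gamma> @ [join_word b \<beta>] @ \<delta>) = weight r (\<gamma> @ \<beta>) * fill_weight 0 \<beta> * weight r \<delta>"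
    and "\<forall>w\<in>set \<gamma>. b \<notin> set w" "b \<in> set (join_word b \<beta>)" "b \<notin> set (concat \<beta>)"
proof -
  have \<gamma>\<beta>: "length \<gamma> = i" "[] \<notin> set \<gamma>" "length \<beta> = Suc r" "valid r (\<gamma> @ \<beta>)"
      "stack_sort2 (\<gamma> @ \<beta>) = [a..<c]"
    and \<delta>: "length \<delta> = k" "[] \<notin> set \<delta>" "valid r \<delta>" "stack_sort2 \<delta> = [c..<b]"
    using assms by (auto simp: mixed_tuples_def sortable_tuples_def)
  have s: "set (concat (\<gamma> @ \<beta>)) = {a..<c}" "set (concat \<delta>) = {c..<b}"
    using \<gamma>\<beta>(5) \<delta>(4) set_stack_sort2 [of "\<gamma> @ \<beta>"] set_stack_sort2 [of \<delta>] by auto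
  have less: "\<forall>x\<in>set (concat (\<gamma> @ \<beta> @ \<delta>)). x < b"
  proof
    fix x assume "x \<in> set (concat (\<gamma> @ \<beta> @ \<delta>))"
    then have "x \<in> set (concat (\<gamma> @ \<beta>)) \<union> set (concat \<delta>)" by simp
    then show "x < b" unfolding s using assms(4) by auto
  qed
  have v: "valid r (\<gamma> @ \<beta> @ \<delta>)"
    using \<gamma>\<beta>(4) \<delta>(3) s valid_append [of r "\<gamma> @ \<beta>" \<delta>] by auto
  have J: "rword r (join_word b \<beta>)"
    using v less \<gamma>\<beta>(3) assms(5) by (subst rword_join_word) (auto simp: valid_append)
  have sJ: "set (join_word b \<beta>) = insert b (set (concat \<beta>))"
    using \<gamma>\<beta>(3) assms(5) by (simp add: set_join_word)
  have "stack_sort2 (\<gamma> @ [join_word b \<beta>] @ \<delta>) = [a..<Suc b]"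
    using \<gamma>\<beta>(3,5) \<delta>(4) assms(3-) upt_add_eq_append [of a c "b - c"]
    by (subst stack_sort2_remove_max [OF less]) auto
  moreover have "valid r (\<gamma> @ [join_word b \<beta>] @ \<delta>)"
    using v J sJ less unfolding valid_append valid_Cons append_Cons append_Nil by auto
  moreover have "join_word b \<beta> \<noteq> []" using sJ by auto
  ultimately show "\<gamma> @ [join_word b \<beta>] @ \<delta> \<in> sortable_tuples r a (Suc b) (Suc (i + k))"
    using \<gamma>\<beta> \<delta> by (simp add: sortable_tuples_def)
  show "weight r (\<gamma> @ [join_word b \<beta>] @ \<delta>) = weight r (\<gamma> @ \<beta>) * fill_weight 0 \<beta> * weight r \<delta>"
    using less \<gamma>\<beta>(3) assms(5) by (intro weight_append_join_word [OF v]) auto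
  show "\<forall>w\<in>set \<gamma>. b \<notin> set w" "b \<in> set (join_word b \<beta>)" "b \<notin> set (concat \<beta>)"
    using less sJ by auto
qed

text \<open>Converse of \<open>remove_max_join\<close>: cut the component containing
  \<open>b\<close> at all copies of \<open>b\<close>. Since the two sorted pieces concatenate to an
  interval, each of them is an interval.\<close>

lemma remove_max_split:
  assumes "\<alpha> \<in> sortable_tuples r a (Suc b) k" "a \<le> b" "r \<ge> 1"
  obtains \<gamma> w \<delta> c where "\<alpha> = \<gamma> @ [w] @ \<delta>" "\<forall>u\<in>set \<gamma>. b \<notin> set u" "b \<in> set w"
    "length \<gamma> < k" "a \<le> c" "c \<le> b"
    "(\<gamma>, split_word b w) \<in> mixed_tuples r a c (length \<gamma>) (Suc r)"
    "\<delta> \<in> sortable_tuples r c b (k - 1 - length \<gamma>)"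
proof -
  have \<alpha>: "length \<alpha> = k" "[] \<notin> set \<alpha>" "valid r \<alpha>" "stack_sort2 \<alpha> = [a..<Suc b]"
    using assms by (auto simp: sortable_tuples_def)
  have s: "set (concat \<alpha>) = {a..b}"
    using \<alpha>(4) set_stack_sort2 [of \<alpha>] by auto
  then have "\<exists>w\<in>set \<alpha>. b \<in> set w" using assms(2) by auto
  then obtain \<gamma> w \<delta> where \<alpha>_eq: "\<alpha> = \<gamma> @ [w] @ \<delta>" and w: "b \<in> set w" and \<gamma>: "\<forall>u\<in>set \<gamma>. b \<notin> set u"
    using split_list_first_prop [of \<alpha> "\<lambda>w. b \<in> set w"] by auto
  define \<beta> where "\<beta> = split_word b w"
  have w_eq: "w = join_word b \<beta>" by (simp add: \<beta>_def join_split_word)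
  have rw: "rword r w" and dw: "disj w (concat \<delta>)"
    using \<alpha>(3) unfolding \<alpha>_eq by (auto simp: valid_append valid_Cons)
  have len: "length \<beta> = Suc r"
    using rw w by (simp add: \<beta>_def length_split_word rword_def)
  have sw: "set w = insert b (set (concat \<beta>))"
    unfolding w_eq using len assms(3) by (simp add: set_join_word)
  have "b \<notin> set (concat (\<gamma> @ \<beta> @ \<delta>))"
    using \<gamma> dw w split_word_no_max [of _ b w] by (auto simp: \<beta>_def)
  moreover have "set (concat (\<gamma> @ \<beta> @ \<delta>)) \<subseteq> {a..b}"
    unfolding s [symmetric] \<alpha>_eq using sw by auto
  ultimately have less: "\<forall>x\<in>set (concat (\<gamma> @ \<beta> @ \<delta>)). x < b"
    by (metis atLeastAtMost_iff le_neq_implies_less subsetD)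
  have v: "valid r \<beta>"
    using rw less len assms(3) unfolding w_eq by (subst (asm) rword_join_word) auto
  have v': "valid r (\<gamma> @ \<beta>)" "valid r \<delta>"
    using \<alpha>(3) v sw unfolding \<alpha>_eq valid_append valid_Cons append_Cons append_Nil by auto
  have "stack_sort2 (\<gamma> @ \<beta>) @ stack_sort2 \<delta> @ [b] = [a..<Suc b]"
    using \<alpha>(4) stack_sort2_remove_max [OF less] len assms(3) unfolding \<alpha>_eq w_eq by simp
  then have "stack_sort2 (\<gamma> @ \<beta>) @ stack_sort2 \<delta> = [a..<b]" using assms(2) by simp
  \<comment> \<open>The cut point is \<open>a\<close> plus the length of the first sorted
    piece.\<close>
  note c = append_eq_upt [OF assms(2) this]
  show thesis
  proof (rule that [OF \<alpha>_eq \<gamma> w])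
    show "length \<gamma> < k" using \<alpha>(1) by (simp add: \<alpha>_eq)
    show "(\<gamma>, split_word b w) \<in> mixed_tuples r a (a + length (stack_sort2 (\<gamma> @ \<beta>))) (length \<gamma>) (Suc r)"
      using \<alpha>(2) v' c(1) len by (simp add: mixed_tuples_def \<alpha>_eq flip: \<beta>_def)
    show "\<delta> \<in> sortable_tuples r (a + length (stack_sort2 (\<gamma> @ \<beta>))) b (k - 1 - length \<gamma>)"
      using \<alpha>(1,2) v' c(2) by (simp add: sortable_tuples_def \<alpha>_eq)
  qed (use c(3) in auto)
qed

text \<open>Bijection between tuples and their pieces: \<open>i\<close> is the number of components
  before the one containing \<open>b\<close>, and \<open>c\<close> is the point where the remaining
  letters are divided.\<close>

lemma sum_sortable_tuples_Suc:
  assumes "a \<le> b" "r \<ge> 1"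
  shows "(\<Sum>\<alpha>\<in>sortable_tuples r a (Suc b) k. weight r \<alpha>) =
    (\<Sum>i<k. \<Sum>c=a..b.
      (\<Sum>(\<gamma>, \<beta>)\<in>mixed_tuples r a c i (Suc r). weight r (\<gamma> @ \<beta>) * fill_weight 0 \<beta>) *
      (\<Sum>\<delta>\<in>sortable_tuples r c b (k - 1 - i). weight r \<delta>))"
proof -
  let ?S = "SIGMA p:{..<k} \<times> {a..b}.
      mixed_tuples r a (snd p) (fst p) (Suc r) \<times> sortable_tuples r (snd p) b (k - 1 - fst p)"
  let ?f = "\<lambda>(p :: nat \<times> nat, (\<gamma>, \<beta>), \<delta>). weight r (\<gamma> @ \<beta>) * fill_weight 0 \<beta> * weight r \<delta>"
  define \<Phi> :: "(nat \<times> nat) \<times> (nat list list \<times> nat list list) \<times> nat list list \<Rightarrow> nat list list"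
    where "\<Phi> = (\<lambda>(p, (\<gamma>, \<beta>), \<delta>). \<gamma> @ [join_word b \<beta>] @ \<delta>)"
  have \<Phi>: "\<Phi> q \<in> sortable_tuples r a (Suc b) k" "weight r (\<Phi> q) = ?f q" if "q \<in> ?S" for q
  proof -
    obtain i c \<gamma> \<beta> \<delta> where q: "q = ((i, c), (\<gamma>, \<beta>), \<delta>)" by (metis prod.collapse)
    have "(\<gamma>, \<beta>) \<in> mixed_tuples r a c i (Suc r)" "\<delta> \<in> sortable_tuples r c b (k - 1 - i)"
      "a \<le> c" "c \<le> b" "i < k"
      using that by (auto simp: q)
    note * = remove_max_join [OF this(1-4) assms(2)] and this(5)
    then show "\<Phi> q \<in> sortable_tuples r a (Suc b) k" "weight r (\<Phi> q) = ?f q"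
      by (simp_all add: q \<Phi>_def)
  qed
  have inj: "inj_on \<Phi> ?S"
  proof (rule inj_onI)
    fix q q' assume q: "q \<in> ?S" and q': "q' \<in> ?S" and eq: "\<Phi> q = \<Phi> q'"
    obtain i c \<gamma> \<beta> \<delta> where qe: "q = ((i, c), (\<gamma>, \<beta>), \<delta>)" by (metis prod.collapse)
    obtain i' c' \<gamma>' \<beta>' \<delta>' where qe': "q' = ((i', c'), (\<gamma>', \<beta>'), \<delta>')" by (metis prod.collapse)
    have m: "(\<gamma>, \<beta>) \<in> mixed_tuples r a c i (Suc r)" "\<delta> \<in> sortable_tuples r c b (k - 1 - i)"
      "a \<le> c" "c \<le> b" "i < k"
      and m': "(\<gamma>', \<beta>') \<in> mixed_tuples r a c' i' (Suc r)" "\<delta>' \<in> sortable_tuples r c' b (k - 1 - i')"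
      "a \<le> c'" "c' \<le> b" "i' < k"
      using q q' by (auto simp: qe qe')
    note j = remove_max_join [OF m(1-4) assms(2)] and j' = remove_max_join [OF m'(1-4) assms(2)]
    have e: "\<gamma> @ join_word b \<beta> # \<delta> = \<gamma>' @ join_word b \<beta>' # \<delta>'"
      using eq by (simp add: qe qe' \<Phi>_def)
    \<comment> \<open>The component containing \<open>b\<close> is unique, so
      \<open>\<gamma>\<close> is the longest initial part of the tuple without
      \<open>b\<close>.\<close>
    have cut: "\<gamma> = takeWhile (\<lambda>w. b \<notin> set w) (\<gamma> @ join_word b \<beta> # \<delta>)"
      "\<gamma>' = takeWhile (\<lambda>w. b \<notin> set w) (\<gamma>' @ join_word b \<beta>' # \<delta>')"
      using j(3,4) j'(3,4) by (auto simp: takeWhile_tail)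
    then have 1: "\<gamma> = \<gamma>'" using e by metis
    with e have 2: "join_word b \<beta> = join_word b \<beta>'" "\<delta> = \<delta>'" by auto
    have "\<beta> \<noteq> []" "\<beta>' \<noteq> []" using m(1) m'(1) by (auto simp: mixed_tuples_def)
    then have 3: "\<beta> = \<beta>'" using 2 j(5) j'(5) split_join_word by metis
    have "[a..<c] = [a..<c']" "i = i'"
      using m(1) m'(1) 1 3 by (auto simp: mixed_tuples_def)
    then have "length [a..<c] = length [a..<c']" by simp
    then have "c = c'" using m(3) m'(3) by simp
    then show "q = q'" using 1 2 3 \<open>i = i'\<close> by (simp add: qe qe')
  qed
  have "\<alpha> \<in> \<Phi> ` ?S" if \<alpha>: "\<alpha> \<in> sortable_tuples r a (Suc b) k" for \<alpha>
  proof -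
    obtain \<gamma> w \<delta> c where *: "\<alpha> = \<gamma> @ [w] @ \<delta>" "length \<gamma> < k" "a \<le> c" "c \<le> b"
      "(\<gamma>, split_word b w) \<in> mixed_tuples r a c (length \<gamma>) (Suc r)"
      "\<delta> \<in> sortable_tuples r c b (k - 1 - length \<gamma>)"
      using remove_max_split [OF \<alpha> assms] by metis
    show ?thesis
      by (rule image_eqI [of _ _ "((length \<gamma>, c), (\<gamma>, split_word b w), \<delta>)"])
        (use * in \<open>auto simp: \<Phi>_def join_split_word\<close>)
  qed
  then have "sortable_tuples r a (Suc b) k = \<Phi> ` ?S" using \<Phi>(1) by blast
  then have "(\<Sum>\<alpha>\<in>sortable_tuples r a (Suc b) k. weight r \<alpha>) = (\<Sum>q\<in>?S. weight r (\<Phi> q))"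
    by (simp only: sum.reindex [OF inj] o_def)
  also have "\<dots> = (\<Sum>q\<in>?S. ?f q)"
    by (rule sum.cong) (simp_all only: \<Phi>(2))
  also have "\<dots> = (\<Sum>p\<in>{..<k} \<times> {a..b}. \<Sum>((\<gamma>, \<beta>), \<delta>)\<in>mixed_tuples r a (snd p) (fst p) (Suc r) \<times>
      sortable_tuples r (snd p) b (k - 1 - fst p). weight r (\<gamma> @ \<beta>) * fill_weight 0 \<beta> * weight r \<delta>)"
    by (subst sum.Sigma [symmetric])
      (auto simp: finite_mixed_tuples finite_sortable_tuples intro!: finite_cartesian_product)
  also have "\<dots> = (\<Sum>p\<in>{..<k} \<times> {a..b}.
      (\<Sum>(\<gamma>, \<beta>)\<in>mixed_tuples r a (snd p) (fst p) (Suc r). weight r (\<gamma> @ \<beta>) * fill_weight 0 \<beta>) *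
      (\<Sum>\<delta>\<in>sortable_tuples r (snd p) b (k - 1 - fst p). weight r \<delta>))"
    by (simp add: sum_product sum.cartesian_product case_prod_unfold)
  also have "\<dots> = (\<Sum>i<k. \<Sum>c=a..b.
      (\<Sum>(\<gamma>, \<beta>)\<in>mixed_tuples r a c i (Suc r). weight r (\<gamma> @ \<beta>) * fill_weight 0 \<beta>) *
      (\<Sum>\<delta>\<in>sortable_tuples r c b (k - 1 - i). weight r \<delta>))"
    by (simp add: sum.cartesian_product case_prod_unfold)
  finally show ?thesis .
qed

lemma stack_sort2_eq_Nil_iff: "stack_sort2 \<alpha> = [] \<longleftrightarrow> (\<forall>w\<in>set \<alpha>. w = [])"
  using set_stack_sort2 [of \<alpha>] by (metis concat_eq_Nil_conv set_empty)

lemma sortable_tuples_empty: "sortable_tuples r a a k = (if k = 0 then {[]} else {})"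
proof -
  have "\<alpha> = []" if "[] \<notin> set \<alpha>" "\<forall>w\<in>set \<alpha>. w = []" for \<alpha> :: "nat list list"
    using that by (cases \<alpha>) auto
  then show ?thesis
    by (auto simp: sortable_tuples_def stack_sort2_eq_Nil_iff valid_def)
qed

text \<open>The part of \<open>f_k r i\<close> coming from \<open>n\<close> letters, with the
  elementary symmetric polynomials expanded over subsets. It counts \<open>i\<close> components
  followed by \<open>r + 1\<close> possibly empty factors.\<close>

definition tuple_gf :: "nat \<Rightarrow> nat \<Rightarrow> nat \<Rightarrow> xseries" where
  "tuple_gf r n i = (\<Sum>I\<in>Pow {..r}. (\<Prod>v\<in>I. mvar v) * g_nk r n (i + card I))"

text \<open>The recursion is the same on all intervals of letters of the same length, so words need not
  be relabelled.\<close>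

lemma sum_sortable_tuples_translate:
  assumes "r \<ge> 1"
  shows "(\<Sum>\<alpha>\<in>sortable_tuples r a (a + n) k. weight r \<alpha>) = g_nk r n k"
proof (induction n arbitrary: a k rule: less_induct)
  case (less n)
  show ?case
  proof (cases n)
    case 0
    then show ?thesis by (simp add: g_nk_eq sortable_tuples_empty)
  next
    case (Suc n')
    let ?w = "\<lambda>a b k. \<Sum>\<alpha>\<in>sortable_tuples r a b k. weight r \<alpha>"
    have IH: "?w a b k = g_nk r (b - a) k" if "a \<le> b" "b - a < n" for a b k
      using less.IH [of "b - a" a k] that by simp
    have "?w a (a + n) k = (\<Sum>i<k. \<Sum>m=0..n'. tuple_gf r m i * g_nk r (n' - m) (k - 1 - i))" for a k
    proof -
      have "?w a (Suc (a + n')) k = (\<Sum>i<k. \<Sum>c=a..a + n'.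
          (\<Sum>I\<in>Pow {0..<0 + Suc r}. (\<Prod>v\<in>I. mvar v) * ?w a c (i + card I)) *
          ?w c (a + n') (k - 1 - i))"
        unfolding sum_mixed_tuples [symmetric]
        by (rule sum_sortable_tuples_Suc) (use assms in auto)
      also have "\<dots> = (\<Sum>i<k. \<Sum>c=a..a + n'. tuple_gf r (c - a) i * g_nk r (a + n' - c) (k - 1 - i))"
        using Suc by (intro sum.cong refl arg_cong2 [where f = "(*)"])
          (auto simp: tuple_gf_def IH atLeast0LessThan lessThan_Suc_atMost)
      also have "\<dots> = (\<Sum>i<k. \<Sum>m=0..n'. tuple_gf r m i * g_nk r (n' - m) (k - 1 - i))"
        by (rule sum.cong [OF refl], rule sum.reindex_bij_witness [where i = "\<lambda>m. a + m" and j = "\<lambda>c. c - a"])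
          (auto simp: add.commute)
      finally show ?thesis by (simp add: Suc)
    qed
    from this [of a k] this [of 1 k] show ?thesis by (simp add: g_nk_eq)
  qed
qed

lemma g_nk_0: "g_nk r 0 k = (if k = 0 then 1 else 0)"
  by (simp add: g_nk_eq sortable_tuples_empty weight_def tuple_descents_def)

text \<open>The alphabet is translated to start at 0, so that the cut point equals the number of
  letters in the first group.\<close>

lemma g_nk_Suc:
  assumes "r \<ge> 1"
  shows "g_nk r (Suc n) k = (\<Sum>i<k. \<Sum>m\<le>n. tuple_gf r m i * g_nk r (n - m) (k - 1 - i))"
proof -
  let ?w = "\<lambda>a b k. \<Sum>\<alpha>\<in>sortable_tuples r a b k. weight r \<alpha>"
  have w: "?w a b k = g_nk r (b - a) k" if "a \<le> b" for a b k
    using sum_sortable_tuples_translate [OF assms, of a "b - a" k] that by simp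
  have "g_nk r (Suc n) k = ?w 0 (Suc n) k" by (simp add: w)
  also have "\<dots> = (\<Sum>i<k. \<Sum>c=0..n.
      (\<Sum>I\<in>Pow {0..<0 + Suc r}. (\<Prod>v\<in>I. mvar v) * ?w 0 c (i + card I)) * ?w c n (k - 1 - i))"
    unfolding sum_mixed_tuples [symmetric]
    by (rule sum_sortable_tuples_Suc) (use assms in auto)
  also have "\<dots> = (\<Sum>i<k. \<Sum>m\<le>n. tuple_gf r m i * g_nk r (n - m) (k - 1 - i))"
    by (intro sum.cong refl arg_cong2 [where f = "(*)"])
      (auto simp: tuple_gf_def w atLeast0LessThan lessThan_Suc_atMost)
  finally show ?thesis .
qed

section \<open>Order filtration of multivariate power series\<close>

lemma mcoeff_simps [simp]:
  "mcoeff 0 m = 0" "mcoeff 1 m = (if m = {#} then 1 else 0)"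
  "mcoeff (f + g) m = mcoeff f m + mcoeff g m" "mcoeff (f - g) m = mcoeff f m - mcoeff g m"
  "mcoeff (- f) m = - mcoeff f m" "mcoeff (mvar v) m = (if m = {#v#} then 1 else 0)"
  "mcoeff (mconst a) m = (if m = {#} then a else 0)"
  by (simp_all add: zero_mfps_def one_mfps_def plus_mfps_def minus_mfps_def uminus_mfps_def
      mvar_def mconst_def)

lemma mcoeff_mult: "mcoeff (f * g) m = (\<Sum>(a, b) | a + b = m. mcoeff f a * mcoeff g b)"
  by (simp add: times_mfps_def)

lemma mcoeff_sum: "mcoeff (sum f A) m = (\<Sum>x\<in>A. mcoeff (f x) m)"
  by (induction A rule: infinite_finite_induct) auto

lemma mcoeff_mult_nonzeroE:
  assumes "mcoeff (f * g) m \<noteq> 0"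
  obtains a b where "a + b = m" "mcoeff f a \<noteq> 0" "mcoeff g b \<noteq> 0"
  using sum.not_neutral_contains_not_neutral [OF assms [unfolded mcoeff_mult]]
  by auto (metis mult_zero_left mult_zero_right)

lemma mcoeff_sum_nonzeroE:
  assumes "mcoeff (sum f A) m \<noteq> 0"
  obtains x where "x \<in> A" "mcoeff (f x) m \<noteq> 0"
  using sum.not_neutral_contains_not_neutral [OF assms [unfolded mcoeff_sum]] by auto

lemma size_prod_mvar:
  "finite I \<Longrightarrow> mcoeff (\<Prod>v\<in>I. mvar v :: ('v, 'a :: comm_ring_1) mfps) m \<noteq> 0 \<Longrightarrow> size m = card I"
proof (induction I arbitrary: m rule: finite_induct)
  case (insert v I)
  then have "mcoeff (mvar v * (\<Prod>v\<in>I. mvar v :: ('v, 'a) mfps)) m \<noteq> 0" by simp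
  then obtain a b where "a + b = m" "mcoeff (mvar v :: ('v, 'a) mfps) a \<noteq> 0"
    "mcoeff (\<Prod>v\<in>I. mvar v :: ('v, 'a) mfps) b \<noteq> 0"
    by (rule mcoeff_mult_nonzeroE)
  then have "a = {#v#}" "size b = card I" using insert.IH by (auto split: if_splits)
  then show ?case using insert.hyps \<open>a + b = m\<close> by auto
qed (auto split: if_splits)

lemma mconst_0 [simp]: "mconst 0 = 0"
  and mconst_1 [simp]: "mconst 1 = 1"
  by (auto intro!: mfps_eqI)

lemma mconst_add: "mconst (a + b) = mconst a + mconst b"
  by (auto intro!: mfps_eqI)

lemma mconst_sum: "mconst (sum f A) = (\<Sum>x\<in>A. mconst (f x))"
  by (induction A rule: infinite_finite_induct) (auto simp: mconst_add)

lemma mconst_mult: "mconst (a * b) = mconst a * mconst b"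
proof (rule mfps_eqI)
  fix m :: "'a multiset"
  have "mcoeff (mconst a * mconst b) m =
      (\<Sum>p | fst p + snd p = m. if p = ({#}, {#}) then a * b else 0)"
    unfolding mcoeff_mult by (rule sum.cong) (auto split: if_splits)
  also have "\<dots> = mcoeff (mconst (a * b)) m"
    using finite_mset_splits [of m] by (auto simp: sum.delta case_prod_unfold)
  finally show "mcoeff (mconst (a * b)) m = mcoeff (mconst a * mconst b) m" by simp
qed

text \<open>The degree filtration, used like a metric: series are equal once their difference has
  every order.\<close>

definition order_ge :: "nat \<Rightarrow> ('v, 'a :: comm_ring_1) mfps \<Rightarrow> bool" where
  "order_ge d f \<longleftrightarrow> (\<forall>m. size m < d \<longrightarrow> mcoeff f m = 0)"

lemma order_ge_0 [simp]: "order_ge 0 f"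
  and order_ge_zero [simp]: "order_ge d 0"
  by (simp_all add: order_ge_def)

lemma order_ge_add: "order_ge d f \<Longrightarrow> order_ge d g \<Longrightarrow> order_ge d (f + g)"
  and order_ge_diff: "order_ge d f \<Longrightarrow> order_ge d g \<Longrightarrow> order_ge d (f - g)"
  by (simp_all add: order_ge_def)

lemma order_ge_sum: "(\<And>x. x \<in> A \<Longrightarrow> order_ge d (f x)) \<Longrightarrow> order_ge d (sum f A)"
  by (simp add: order_ge_def mcoeff_sum)

lemma order_ge_mono: "order_ge d f \<Longrightarrow> d' \<le> d \<Longrightarrow> order_ge d' f"
  by (auto simp: order_ge_def)

lemma order_ge_mult: "order_ge d f \<Longrightarrow> order_ge e g \<Longrightarrow> order_ge (d + e) (f * g)"
proof (unfold order_ge_def, intro allI impI, rule ccontr)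
  fix m assume f: "\<forall>m. size m < d \<longrightarrow> mcoeff f m = 0" and g: "\<forall>m. size m < e \<longrightarrow> mcoeff g m = 0"
    and m: "size m < d + e" and n: "mcoeff (f * g) m \<noteq> 0"
  obtain a b where "a + b = m" "mcoeff f a \<noteq> 0" "mcoeff g b \<noteq> 0"
    using n by (rule mcoeff_mult_nonzeroE)
  with f g m show False by (metis add_mono not_less size_union)
qed

lemma order_ge_mult1: "order_ge d f \<Longrightarrow> order_ge d (f * g)"
  and order_ge_mult2: "order_ge d g \<Longrightarrow> order_ge d (f * g)"
  using order_ge_mult [of d f 0 g] order_ge_mult [of 0 f d g] by simp_all

lemma order_ge_eqI: "(\<And>d. order_ge d (f - g)) \<Longrightarrow> f = g"
  by (rule mfps_eqI) (metis order_ge_def lessI mcoeff_simps(4) right_minus_eq)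

lemma order_ge_prod_mvar: "finite I \<Longrightarrow> order_ge (card I) (\<Prod>v\<in>I. mvar v)"
  unfolding order_ge_def using size_prod_mvar by (metis less_irrefl)

lemma order_ge_1_iff: "order_ge (Suc 0) f \<longleftrightarrow> mcoeff f {#} = 0"
  by (auto simp: order_ge_def)

lemma order_ge_trans: "order_ge d (f - g) \<Longrightarrow> order_ge d (g - h) \<Longrightarrow> order_ge d (f - h)"
  using order_ge_add [of d "f - g" "g - h"] by simp

lemma order_ge_sym: "order_ge d (f - g) \<Longrightarrow> order_ge d (g - f)"
  by (simp add: order_ge_def)

text \<open>Outer induction on the order \<open>d\<close>, inner induction on \<open>k\<close>. In
  \<open>\<phi> g i\<close> the term for \<open>I = {}\<close> has an index below \<open>k\<close>,
  covered by the inner induction; the other terms may have larger indices, but their product of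
  variables raises the order by at least one, so the outer induction suffices.\<close>

lemma catalytic_system_unique:
  fixes g g' :: "nat \<Rightarrow> xseries" and r :: nat
  defines "\<phi> \<equiv> \<lambda>g i. \<Sum>I\<in>Pow {..r}. (\<Prod>v\<in>I. mvar v) * (g (i + card I) :: xseries)"
  assumes g: "g 0 = 1" "\<And>k. g (Suc k) = (\<Sum>i\<le>k. \<phi> g i * g (k - i))"
    and g': "g' 0 = 1" "\<And>k. g' (Suc k) = (\<Sum>i\<le>k. \<phi> g' i * g' (k - i))"
  shows "g = g'"
proof
  fix k
  have "order_ge d (g k - g' k)" for d
  proof (induction d arbitrary: k)
    case (Suc d)
    note IHd = this
    show ?case
    proof (induction k rule: less_induct)
      case (less k)
      show ?case
      proof (cases k)
        case (Suc l)
        have \<phi>: "order_ge (Suc d) (\<phi> g i - \<phi> g' i)" if "i \<le> l" for i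
        proof -
          have "order_ge (Suc d) ((\<Prod>v\<in>I. mvar v) * (g (i + card I) - g' (i + card I)))"
            if I: "I \<in> Pow {..r}" for I
          proof (cases "I = {}")
            case True
            then show ?thesis using less [of i] \<open>i \<le> l\<close> Suc by simp
          next
            case False
            have fin: "finite I" using I by (auto intro: finite_subset)
            then have "card I \<ge> 1" using False by (simp add: Suc_le_eq card_gt_0_iff)
            then show ?thesis
              using order_ge_mono [OF order_ge_mult [OF order_ge_prod_mvar [OF fin] IHd [of "i + card I"]]]
              by simp
          qed
          then show ?thesis
            unfolding \<phi>_def sum_subtractf [symmetric] right_diff_distrib [symmetric]
            by (rule order_ge_sum)
        qed
        have "order_ge (Suc d) (\<phi> g i * g (l - i) - \<phi> g' i * g' (l - i))" if "i \<le> l" for i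
        proof -
          have "\<phi> g i * g (l - i) - \<phi> g' i * g' (l - i) =
              (\<phi> g i - \<phi> g' i) * g (l - i) + \<phi> g' i * (g (l - i) - g' (l - i))"
            by (simp add: algebra_simps)
          then show ?thesis
            using \<phi> [OF that] less [of "l - i"] Suc
            by (simp add: order_ge_add order_ge_mult1 order_ge_mult2)
        qed
        then show ?thesis
          unfolding Suc g g' sum_subtractf [symmetric] by (intro order_ge_sum) auto
      qed (simp add: g g')
    qed
  qed simp
  then show "g k = g' k" by (rule order_ge_eqI)
qed

section \<open>The change of variables\<close>

lemma mcoeff_E_prod_empty: "(\<And>i. i \<le> r \<Longrightarrow> mcoeff (y i) {#} = 0) \<Longrightarrow> mcoeff (E_prod r y) {#} = 1"
  unfolding E_prod_def
proof -
  assume *: "\<And>i. i \<le> r \<Longrightarrow> mcoeff (y i) {#} = 0"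
  have "mcoeff (\<Prod>i\<in>A. 1 + y i) {#} = 1" if "finite A" "A \<subseteq> {..r}" for A
    using that by (induction A rule: finite_induct) (auto simp: mcoeff_mult_empty *)
  then show "mcoeff (\<Prod>i\<le>r. 1 + y i) {#} = 1" by simp
qed

lemma order_ge_diff_E_prod:
  assumes "\<And>i. i \<le> r \<Longrightarrow> order_ge d (y i - y' i)"
  shows "order_ge d (E_prod r y - E_prod r y')"
proof -
  have "order_ge d ((\<Prod>i\<in>A. 1 + y i) - (\<Prod>i\<in>A. 1 + y' i))" if "finite A" "A \<subseteq> {..r}" for A
    using that
  proof (induction A rule: finite_induct)
    case (insert j A)
    have "(\<Prod>i\<in>insert j A. 1 + y i) - (\<Prod>i\<in>insert j A. 1 + y' i) =
      (y j - y' j) * (\<Prod>i\<in>A. 1 + y i) + (1 + y' j) * ((\<Prod>i\<in>A. 1 + y i) - (\<Prod>i\<in>A. 1 + y' i))"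
      using insert by (simp add: algebra_simps)
    then show ?case using insert assms [of j]
      by (simp add: order_ge_add order_ge_mult1 order_ge_mult2)
  qed simp
  then show ?thesis unfolding E_prod_def by simp
qed

text \<open>The defining equation solved for its linear term,
  \<open>y\<^sub>j = x\<^sub>j E(y)\<^sup>2 - y\<^sub>j\<^sup>2\<close>, so that solutions are fixed
  points.\<close>

definition y_step :: "nat \<Rightarrow> (nat \<Rightarrow> xseries) \<Rightarrow> nat \<Rightarrow> xseries" where
  "y_step r y j = mvar j * (E_prod r y)\<^sup>2 - (y j)\<^sup>2"

text \<open>Both differences of squares factor, and the cofactors \<open>mvar j\<close> and
  \<open>y j + y' j\<close> have order at least 1.\<close>

lemma y_step_contraction:
  assumes "\<And>i. i \<le> r \<Longrightarrow> order_ge d (y i - y' i)"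
    and "\<And>i. i \<le> r \<Longrightarrow> order_ge 1 (y i)" "\<And>i. i \<le> r \<Longrightarrow> order_ge 1 (y' i)" "j \<le> r"
  shows "order_ge (Suc d) (y_step r y j - y_step r y' j)"
proof -
  have "y_step r y j - y_step r y' j =
     mvar j * ((E_prod r y - E_prod r y') * (E_prod r y + E_prod r y')) - (y j + y' j) * (y j - y' j)"
    by (simp add: y_step_def algebra_simps power2_eq_square)
  moreover have "order_ge (1 + d) (mvar j * ((E_prod r y - E_prod r y') * (E_prod r y + E_prod r y')))"
    by (intro order_ge_mult order_ge_mult1 order_ge_diff_E_prod assms) (auto simp: order_ge_def)
  moreover have "order_ge (1 + d) ((y j + y' j) * (y j - y' j))"
    by (intro order_ge_mult order_ge_add assms)
  ultimately show ?thesis by (simp add: order_ge_diff)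
qed

lemma mvar_eq_iff_y_step:
  assumes "\<And>i. i \<le> r \<Longrightarrow> mcoeff (y i) {#} = 0"
  shows "mvar j = y j * (1 + y j) / (E_prod r y)\<^sup>2 \<longleftrightarrow> y_step r y j = y j"
proof -
  let ?E = "(E_prod r y)\<^sup>2"
  have "mcoeff ?E {#} \<noteq> 0"
    using mcoeff_E_prod_empty [OF assms] by (simp add: power2_eq_square mcoeff_mult_empty)
  then have E: "?E * inverse ?E = 1" by (rule mfps_inverse_right)
  have "mvar j = y j * (1 + y j) / ?E \<longleftrightarrow> mvar j * ?E = y j * (1 + y j)"
  proof
    assume "mvar j = y j * (1 + y j) / ?E"
    then have "mvar j * ?E = y j * (1 + y j) * (?E * inverse ?E)"
      by (simp add: divide_mfps_def ac_simps)
    then show "mvar j * ?E = y j * (1 + y j)" by (simp add: E)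
  next
    assume *: "mvar j * ?E = y j * (1 + y j)"
    have "mvar j = mvar j * (?E * inverse ?E)" by (simp add: E)
    also have "\<dots> = y j * (1 + y j) * inverse ?E" unfolding mult.assoc [symmetric] * by simp
    finally show "mvar j = y j * (1 + y j) / ?E" by (simp add: divide_mfps_def)
  qed
  also have "\<dots> \<longleftrightarrow> y_step r y j = y j"
    by (simp add: y_step_def distrib_left power2_eq_square diff_eq_eq)
  finally show ?thesis .
qed

lemma mvars_in_simps:
  "mvars_in V 1" "v \<in> V \<Longrightarrow> mvars_in V (mvar v)"
  "mvars_in V f \<Longrightarrow> mvars_in V g \<Longrightarrow> mvars_in V (f + g)"
  "mvars_in V f \<Longrightarrow> mvars_in V g \<Longrightarrow> mvars_in V (f - g)"
  by (force simp: mvars_in_def)+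

lemma mvars_in_mult: "mvars_in V f \<Longrightarrow> mvars_in V g \<Longrightarrow> mvars_in V (f * g)"
  unfolding mvars_in_def by (metis mcoeff_mult_nonzeroE set_mset_union Un_least)

lemma mvars_in_prod: "(\<And>i. i \<in> A \<Longrightarrow> mvars_in V (f i)) \<Longrightarrow> mvars_in V (prod f A)"
  by (induction A rule: infinite_finite_induct) (auto simp: mvars_in_simps mvars_in_mult)

text \<open>Fixed point iteration from 0: contraction makes the iterates converge in the degree
  filtration and makes the fixed point unique.\<close>

lemma ex1_is_y: "\<exists>!y. is_y r y"
proof (rule ex_ex1I)
  define Y where "Y n = (y_step r ^^ n) (\<lambda>_. 0)" for n
  have Y_Suc: "Y (Suc n) = y_step r (Y n)" for n by (simp add: Y_def)
  have Y1: "order_ge 1 (Y n j)" if "j \<le> r" for n j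
  proof (induction n)
    case (Suc n)
    then show ?case unfolding Y_Suc y_step_def power2_eq_square
      by (intro order_ge_diff order_ge_mult1) (auto simp: order_ge_def)
  qed (simp add: Y_def)
  have step: "order_ge (Suc n) (Y (Suc n) j - Y n j)" if "j \<le> r" for n j
    using that
  proof (induction n arbitrary: j)
    case 0
    then show ?case using Y1 [of j 1] by (simp add: Y_def)
  next
    case (Suc n)
    then show ?case unfolding Y_Suc [of "Suc n"] Y_Suc [of n]
      by (intro y_step_contraction) (auto simp flip: Y_Suc intro: Y1 [unfolded One_nat_def])
  qed
  have Cauchy: "order_ge (Suc n) (Y (n + k) j - Y n j)" if "j \<le> r" for n k j
  proof (induction k)
    case (Suc k)
    have "order_ge (Suc n) (Y (n + Suc k) j - Y (n + k) j)"
      using step [OF that, of "n + k"] by (auto intro: order_ge_mono)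
    from order_ge_trans [OF this Suc] show ?case .
  qed simp
  \<comment> \<open>All iterates from \<open>Y n\<close> on agree up to degree \<open>n\<close>, so
    the coefficient at \<open>m\<close> is final at iterate \<open>size m\<close>. Outside
    \<open>{..r}\<close> the value is \<open>undefined\<close> because \<open>is_y\<close> asks for
    an extensional function.\<close>
  define L where "L j = (if j \<le> r then Abs_mfps (\<lambda>m. mcoeff (Y (size m) j) m) else undefined)" for j
  have L: "order_ge (Suc n) (L j - Y n j)" if "j \<le> r" for n j
    unfolding order_ge_def
  proof (intro allI impI)
    fix m :: "nat multiset" assume "size m < Suc n"
    then show "mcoeff (L j - Y n j) m = 0"
      using Cauchy [OF that, of "size m" "n - size m"] that by (auto simp: L_def order_ge_def)
  qed
  have L1: "order_ge 1 (L j)" if "j \<le> r" for j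
    using L [OF that, of 0] by (simp add: Y_def)
  then have L0: "mcoeff (L j) {#} = 0" if "j \<le> r" for j
    using that by (simp add: order_ge_1_iff)
  have fix_L: "y_step r L j = L j" if "j \<le> r" for j
  proof (rule order_ge_eqI)
    fix d
    have "order_ge (Suc (Suc d)) (y_step r L j - Y (Suc d) j)"
      unfolding Y_Suc using that by (intro y_step_contraction L L1 Y1)
    moreover have "order_ge (Suc (Suc d)) (Y (Suc d) j - L j)"
      using L [OF that, of "Suc d"] by (rule order_ge_sym)
    ultimately have "order_ge (Suc (Suc d)) (y_step r L j - L j)" by (rule order_ge_trans)
    then show "order_ge d (y_step r L j - L j)" by (rule order_ge_mono) simp
  qed
  have vars_Y: "mvars_in {..r} (Y n j)" if "j \<le> r" for n j
    using that
  proof (induction n arbitrary: j)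
    case (Suc n)
    then show ?case unfolding Y_Suc y_step_def power2_eq_square E_prod_def
      by (intro mvars_in_simps mvars_in_mult mvars_in_prod) auto
  qed (simp add: Y_def mvars_in_def)
  have "is_y r L"
    unfolding is_y_def
  proof (intro conjI allI impI PiE_I CollectI)
    fix j assume j: "j \<in> {..r}"
    show "mvars_in {..r} (L j)"
      using vars_Y [of j] j unfolding mvars_in_def by (auto simp: L_def)
    show "mcoeff (L j) {#} = 0" using L0 j by simp
  next
    fix j assume "j \<le> r"
    then show "mvar j = L j * (1 + L j) / (E_prod r L)\<^sup>2"
      using fix_L L0 mvar_eq_iff_y_step [of r L j] by blast
  qed (simp add: L_def)
  then show "\<exists>y. is_y r y" by blast
next
  fix y y' assume y: "is_y r y" and y': "is_y r y'"
  have z: "mcoeff (y j) {#} = 0" "mcoeff (y' j) {#} = 0" if "j \<le> r" for j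
    using y y' that by (auto simp: is_y_def PiE_iff)
  have fix_y: "y_step r y j = y j" "y_step r y' j = y' j" if "j \<le> r" for j
    using y y' that mvar_eq_iff_y_step [of r y j, OF z(1)] mvar_eq_iff_y_step [of r y' j, OF z(2)]
    unfolding is_y_def by blast+
  have "order_ge d (y j - y' j)" if "j \<le> r" for d j
    using that
  proof (induction d arbitrary: j)
    case (Suc d)
    have "order_ge (Suc d) (y_step r y j - y_step r y' j)"
      by (rule y_step_contraction) (simp_all add: Suc order_ge_1_iff z)
    then show ?case by (simp only: fix_y Suc.prems)
  qed simp
  then have eq: "y j = y' j" if "j \<le> r" for j by (rule order_ge_eqI) (rule that)
  have "y \<in> {..r} \<rightarrow>\<^sub>E UNIV" "y' \<in> {..r} \<rightarrow>\<^sub>E UNIV"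
    using y y' unfolding is_y_def by (auto simp: PiE_iff)
  then show "y = y'" by (rule PiE_ext) (simp add: eq)
qed

section \<open>The functional equations\<close>

text \<open>The homogeneity of \<open>g_nk\<close> is an explicit hypothesis since the lemma is
  applied within the induction that proves it.\<close>

lemma size_tuple_gf:
  assumes "\<And>k m. mcoeff (g_nk r n k) m \<noteq> 0 \<Longrightarrow> size m + k = n"
    and "mcoeff (tuple_gf r n i) m \<noteq> 0"
  shows "size m + i = n"
proof -
  obtain I where I: "I \<subseteq> {..r}" "mcoeff ((\<Prod>v\<in>I. mvar v) * g_nk r n (i + card I)) m \<noteq> 0"
    using assms(2) unfolding tuple_gf_def by (auto elim: mcoeff_sum_nonzeroE)
  then obtain a b where ab: "a + b = m" "mcoeff (\<Prod>v\<in>I. mvar v :: xseries) a \<noteq> 0"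
    "mcoeff (g_nk r n (i + card I)) b \<noteq> 0"
    by (auto elim: mcoeff_mult_nonzeroE)
  have "finite I" using I(1) by (rule finite_subset) simp
  then show ?thesis using size_prod_mvar [OF _ ab(2)] assms(1) [OF ab(3)] ab(1) by auto
qed

text \<open>Induction along \<open>g_nk_Suc\<close>, whose two factors have degrees
  \<open>m - i\<close> and \<open>(n - m) - (k - 1 - i)\<close>. This homogeneity leaves a single
  \<open>n\<close> for each coefficient of \<open>g_k\<close>.\<close>

lemma size_g_nk:
  assumes "r \<ge> 1" "mcoeff (g_nk r n k) m \<noteq> 0"
  shows "size m + k = n"
  using assms(2)
proof (induction n arbitrary: k m rule: less_induct)
  case (less n)
  show ?case
  proof (cases n)
    case 0
    then show ?thesis using less.prems by (auto simp: g_nk_0 split: if_splits)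
  next
    case (Suc l)
    obtain i j where ij: "i < k" "j \<le> l" "mcoeff (tuple_gf r j i * g_nk r (l - j) (k - 1 - i)) m \<noteq> 0"
      using less.prems unfolding Suc g_nk_Suc [OF assms(1)] by (auto elim!: mcoeff_sum_nonzeroE)
    then obtain a b where ab: "a + b = m" "mcoeff (tuple_gf r j i) a \<noteq> 0"
      "mcoeff (g_nk r (l - j) (k - 1 - i)) b \<noteq> 0"
      by (auto elim: mcoeff_mult_nonzeroE)
    have "size a + i = j"
      by (rule size_tuple_gf [OF less.IH ab(2)]) (use ij Suc in auto)
    moreover have "size b + (k - 1 - i) = l - j"
      by (rule less.IH [OF _ ab(3)]) (use Suc in auto)
    ultimately show ?thesis using ab(1) ij(1,2) Suc by auto
  qed
qed

lemma mcoeff_g_k: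
  assumes "r \<ge> 1"
  shows "mcoeff (g_k r k) m = mcoeff (g_nk r (size m + k) k) m"
proof -
  have "{n. mcoeff (g_nk r n k) m \<noteq> 0} \<subseteq> {size m + k}"
    using size_g_nk [OF assms] by auto
  then have "(\<Sum>n | mcoeff (g_nk r n k) m \<noteq> 0. mcoeff (g_nk r n k) m) =
      (\<Sum>n\<in>{size m + k}. mcoeff (g_nk r n k) m)"
    by (intro sum.mono_neutral_left) auto
  then show ?thesis by (simp add: g_k_def)
qed

lemma f_k_eq: "f_k r i = (\<Sum>I\<in>Pow {..r}. (\<Prod>v\<in>I. mvar v) * g_k r (i + card I))"
proof -
  have "(\<Sum>I\<in>Pow {..r}. (\<Prod>v\<in>I. mvar v) * g_k r (i + card I)) =
      (\<Sum>j\<le>Suc r. \<Sum>I\<in>{I \<in> Pow {..r}. card I = j}. (\<Prod>v\<in>I. mvar v) * g_k r (i + card I))"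
  proof (rule sum.group [symmetric])
    show "card ` Pow {..r} \<subseteq> {..Suc r}"
      using card_mono [of "{..r}"] by auto
  qed auto
  also have "\<dots> = f_k r i"
    unfolding f_k_def esym_def
    by (auto simp: sum_distrib_left mult.commute intro!: sum.cong)
  finally show ?thesis by simp
qed

text \<open>The monomial of \<open>I\<close> uses up degree \<open>card I\<close>, so every term
  asks for the same number \<open>size m + i\<close> of letters.\<close>

lemma mcoeff_f_k:
  assumes "r \<ge> 1"
  shows "mcoeff (f_k r i) m = mcoeff (tuple_gf r (size m + i) i) m"
proof -
  have "mcoeff ((\<Prod>v\<in>I. mvar v) * g_k r (i + card I)) m =
      mcoeff ((\<Prod>v\<in>I. mvar v) * g_nk r (size m + i) (i + card I)) m" if I: "I \<in> Pow {..r}" for I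
    unfolding mcoeff_mult
  proof (rule sum.cong)
    fix p assume "p \<in> {(a, b). a + b = m}"
    then obtain a b where p: "p = (a, b)" "a + b = m" by auto
    have fin: "finite I" using I by (auto intro: finite_subset)
    have "size b + (i + card I) = size m + i" if "mcoeff (\<Prod>v\<in>I. mvar v :: xseries) a \<noteq> 0"
      using size_prod_mvar [OF fin that] p(2) by auto
    then have "mcoeff (\<Prod>v\<in>I. mvar v :: xseries) a = 0 \<or>
        mcoeff (g_k r (i + card I)) b = mcoeff (g_nk r (size m + i) (i + card I)) b"
      by (metis mcoeff_g_k [OF assms])
    then show "(case p of (a, b) \<Rightarrow> mcoeff (\<Prod>v\<in>I. mvar v) a * mcoeff (g_k r (i + card I)) b) =
        (case p of (a, b) \<Rightarrow> mcoeff (\<Prod>v\<in>I. mvar v) a * mcoeff (g_nk r (size m + i) (i + card I)) b)"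
      by (auto simp: p)
  qed simp
  then show ?thesis unfolding f_k_eq tuple_gf_def mcoeff_sum by (rule sum.cong [OF refl])
qed

lemma g_k_0:
  assumes "r \<ge> 1"
  shows "g_k r 0 = 1"
proof (rule mfps_eqI)
  fix m :: "nat multiset"
  show "mcoeff (g_k r 0) m = mcoeff 1 m"
    by (cases "size m") (auto simp: mcoeff_g_k [OF assms] g_nk_0 g_nk_Suc [OF assms])
qed

text \<open>Coefficient form of \<open>G = 1 + z F G\<close>. For a splitting
  \<open>a + b = m\<close> homogeneity leaves only the summand \<open>j = size a + i\<close> of the
  sum over \<open>j\<close>.\<close>

lemma g_k_Suc:
  assumes "r \<ge> 1"
  shows "g_k r (Suc k) = (\<Sum>i\<le>k. f_k r i * g_k r (k - i))"
proof (rule mfps_eqI)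
  fix m :: "nat multiset"
  have "mcoeff (g_k r (Suc k)) m =
      (\<Sum>i\<le>k. \<Sum>j\<le>size m + k. mcoeff (tuple_gf r j i * g_nk r (size m + k - j) (k - i)) m)"
    by (simp add: mcoeff_g_k [OF assms] g_nk_Suc [OF assms] mcoeff_sum lessThan_Suc_atMost)
  also have "\<dots> = (\<Sum>i\<le>k. mcoeff (f_k r i * g_k r (k - i)) m)"
  proof (rule sum.cong)
    fix i assume i: "i \<in> {..k}"
    have "(\<Sum>j\<le>size m + k. mcoeff (tuple_gf r j i * g_nk r (size m + k - j) (k - i)) m) =
        (\<Sum>(a, b) | a + b = m. \<Sum>j\<le>size m + k.
          mcoeff (tuple_gf r j i) a * mcoeff (g_nk r (size m + k - j) (k - i)) b)"
      unfolding mcoeff_mult by (subst sum.swap) (simp add: case_prod_unfold)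
    also have "\<dots> = (\<Sum>(a, b) | a + b = m. mcoeff (f_k r i) a * mcoeff (g_k r (k - i)) b)"
    proof (rule sum.cong)
      fix p assume "p \<in> {(a, b). a + b = m}"
      then obtain a b where p: "p = (a, b)" "a + b = m" by auto
      have "(\<Sum>j\<le>size m + k. mcoeff (tuple_gf r j i) a * mcoeff (g_nk r (size m + k - j) (k - i)) b) =
          (\<Sum>j\<in>{size a + i}. mcoeff (tuple_gf r j i) a * mcoeff (g_nk r (size m + k - j) (k - i)) b)"
        using i p(2) size_tuple_gf [OF size_g_nk [OF assms]]
        by (intro sum.mono_neutral_right) auto
      also have "\<dots> = mcoeff (f_k r i) a * mcoeff (g_k r (k - i)) b"
      proof -
        have "size m + k - (size a + i) = size b + (k - i)" using i p(2) by auto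
        then show ?thesis by (simp add: mcoeff_f_k [OF assms] mcoeff_g_k [OF assms])
      qed
      finally show "(case p of (a, b) \<Rightarrow> \<Sum>j\<le>size m + k.
          mcoeff (tuple_gf r j i) a * mcoeff (g_nk r (size m + k - j) (k - i)) b) =
          (case p of (a, b) \<Rightarrow> mcoeff (f_k r i) a * mcoeff (g_k r (k - i)) b)"
        by (simp add: p)
    qed simp
    finally show "(\<Sum>j\<le>size m + k. mcoeff (tuple_gf r j i * g_nk r (size m + k - j) (k - i)) m) =
        mcoeff (f_k r i * g_k r (k - i)) m"
      by (simp only: mcoeff_mult)
  qed simp
  finally show "mcoeff (g_k r (Suc k)) m = mcoeff (\<Sum>i\<le>k. f_k r i * g_k r (k - i)) m"
    by (simp only: mcoeff_sum)
qed

section \<open>The closed form\<close>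

unbundle fps_syntax

text \<open>The root has constant term 1, so the division by \<open>2 * fps_X\<close> is exact;
  squaring \<open>1 - 2 X c\<close> and cancelling \<open>4 X\<close> gives the equation.\<close>

lemma catalan_fps_eq:
  "catalan_fps = 1 + fps_X * catalan_fps\<^sup>2"
proof -
  define s :: "rat fps" where "s = fps_radical (\<lambda>_ _. 1) 2 (1 - 4 * fps_X)"
  have X4: "(4 * fps_X :: rat fps) $ 0 = 0" by simp
  have s2: "s\<^sup>2 = 1 - 4 * fps_X"
    using power_radical [of "1 - 4 * fps_X :: rat fps" "\<lambda>_ _. 1" 1] X4
    by (simp add: s_def numeral_2_eq_2)
  have s0: "s $ 0 = 1" by (simp add: s_def fps_radical_def numeral_2_eq_2)
  have "2 * fps_X = fps_const 2 * (fps_X :: rat fps)" by (simp add: numeral_fps_const)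
  then have "subdegree (2 * fps_X :: rat fps) = 1" by simp
  moreover have "1 - s = 0 \<or> subdegree (1 - s) \<ge> 1"
    using s0 by (cases "1 - s = 0") (auto intro!: subdegree_geI)
  ultimately have "(2 * fps_X) dvd (1 - s)"
    by (cases "1 - s = 0") (simp_all add: fps_dvd_iff)
  then have c: "2 * fps_X * catalan_fps = 1 - s"
    by (simp add: catalan_fps_def flip: s_def)
  have "(1 - 2 * fps_X * catalan_fps)\<^sup>2 = 1 - 4 * fps_X"
    unfolding c using s2 by simp
  then have "4 * fps_X * (fps_X * catalan_fps\<^sup>2 + 1 - catalan_fps) = 0"
    by (simp add: power2_eq_square algebra_simps)
  moreover have "4 * fps_X \<noteq> (0 :: rat fps)" by simp
  ultimately have "fps_X * catalan_fps\<^sup>2 + 1 - catalan_fps = 0"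
    using mult_eq_0_iff by blast
  then show ?thesis by (simp add: algebra_simps)
qed

lemma catalan_nth_0: "catalan_fps $ 0 = 1"
  by (subst catalan_fps_eq) simp

lemma catalan_nth_Suc: "catalan_fps $ Suc n = (\<Sum>i\<le>n. catalan_fps $ i * catalan_fps $ (n - i))"
proof -
  have "catalan_fps $ Suc n = (catalan_fps\<^sup>2) $ n" by (subst catalan_fps_eq) simp
  then show ?thesis by (simp add: power2_eq_square fps_mult_nth atLeast0AtMost)
qed

text \<open>Substituting a multiple \<open>a z\<close> of the variable only rescales the
  coefficients.\<close>

lemma catalan_at_nth:
  "catalan_at (fps_X * fps_const a) $ n = mconst (catalan_fps $ n) * a ^ n"
proof -
  have "((fps_X * fps_const a) ^ i) $ n = (if n = i then a ^ n else 0)" for i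
    by (auto simp: power_mult_distrib fps_X_power_mult_nth)
  then show ?thesis
    by (simp add: catalan_at_def fps_compose_nth if_distrib [of "\<lambda>x. _ * x"] cong: if_cong)
qed

lemma catalan_at_eq:
  fixes a :: xseries
  defines "t \<equiv> fps_X * fps_const a"
  shows "catalan_at t = 1 + t * (catalan_at t)\<^sup>2"
proof (rule fps_ext)
  fix n
  show "catalan_at t $ n = (1 + t * (catalan_at t)\<^sup>2) $ n"
  proof (cases n)
    case 0
    then show ?thesis by (simp add: t_def catalan_at_nth catalan_nth_0)
  next
    case (Suc l)
    have "catalan_at t $ n = (\<Sum>i\<le>l. mconst (catalan_fps $ i) * mconst (catalan_fps $ (l - i)) * a ^ Suc l)"
      by (simp add: Suc t_def catalan_at_nth catalan_nth_Suc mconst_sum mconst_mult sum_distrib_right)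
    also have "\<dots> = a * (\<Sum>i\<le>l. catalan_at t $ i * catalan_at t $ (l - i))"
      unfolding sum_distrib_left
    proof (rule sum.cong)
      fix i assume "i \<in> {..l}"
      then have "a ^ Suc l = a * (a ^ i * a ^ (l - i))" by (simp flip: power_add)
      then show "mconst (catalan_fps $ i) * mconst (catalan_fps $ (l - i)) * a ^ Suc l =
          a * (catalan_at t $ i * catalan_at t $ (l - i))"
        by (simp only: t_def catalan_at_nth ac_simps)
    qed simp
    also have "\<dots> = (1 + t * (catalan_at t)\<^sup>2) $ n"
      by (simp add: Suc t_def mult.assoc power2_eq_square) (simp add: fps_mult_nth atLeast0AtMost)
    finally show ?thesis .
  qed
qed

section \<open>Inverses and exact quotients of power series in \<open>z\<close>\<close>

lemma fps_inverse_right: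
  fixes f :: "('v, 'a :: field) mfps fps"
  assumes "mcoeff (f $ 0) {#} \<noteq> 0"
  shows "f * inverse f = 1"
  unfolding fps_inverse_def by (rule fps_right_inverse) (rule mfps_inverse_right [OF assms])

lemma fps_divide_eq:
  fixes f g :: "('v, 'a :: field) mfps fps"
  assumes "mcoeff (g $ 0) {#} \<noteq> 0"
  shows "f / g = f * inverse g"
proof -
  have "g $ 0 \<noteq> 0" using assms by auto
  then have "subdegree g = 0" by (rule subdegree_eq_0)
  then show ?thesis by (simp add: fps_divide_def)
qed

text \<open>The divisor has subdegree 1, so the quotient involves a shift by one, which loses
  nothing because \<open>f\<close> has no constant term. This is the division by \<open>t\<close> in
  the formula for \<open>F\<close>.\<close>

lemma fps_divide_X_mult:
  fixes f g :: "('v, 'a :: field) mfps fps"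
  assumes "mcoeff (g $ 0) {#} \<noteq> 0" "f $ 0 = 0"
  shows "fps_X * g * (f / (fps_X * g)) = f"
proof -
  have g0: "g $ 0 \<noteq> 0" using assms by auto
  have sd: "subdegree (fps_X * g) = 1"
    by (rule subdegreeI) (use g0 in auto)
  have "fps_shift 1 (fps_X * g) = g" by (rule fps_ext) simp
  then have "f / (fps_X * g) = fps_shift 1 (f * inverse g)"
    by (simp add: fps_divide_def sd)
  moreover have "fps_X * fps_shift 1 (f * inverse g) = f * inverse g"
    by (rule fps_ext) (use assms(2) in auto)
  ultimately have "fps_X * g * (f / (fps_X * g)) = f * (g * inverse g)"
    by (metis mult.assoc mult.commute)
  then show ?thesis by (simp add: fps_inverse_right [OF assms(1)])
qed

section \<open>Bounds on the degree in \<open>z\<close>\<close>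

definition degree_le :: "nat \<Rightarrow> 'a :: comm_ring_1 fps \<Rightarrow> bool" where
  "degree_le d f \<longleftrightarrow> (\<forall>n>d. f $ n = 0)"

lemma degree_le_diff: "degree_le d f \<Longrightarrow> degree_le d g \<Longrightarrow> degree_le d (f - g)"
  by (simp add: degree_le_def)

lemma degree_le_sum: "(\<And>x. x \<in> A \<Longrightarrow> degree_le d (f x)) \<Longrightarrow> degree_le d (sum f A)"
  by (simp add: degree_le_def fps_sum_nth)

lemma degree_le_mono: "degree_le d f \<Longrightarrow> d \<le> e \<Longrightarrow> degree_le e f"
  by (simp add: degree_le_def)

lemma degree_le_mult: "degree_le d f \<Longrightarrow> degree_le e g \<Longrightarrow> degree_le (d + e) (f * g)"
  unfolding degree_le_def fps_mult_nth
proof (intro allI impI sum.neutral ballI)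
  fix n i assume f: "\<forall>n>d. f $ n = 0" and g: "\<forall>n>e. g $ n = 0" and n: "d + e < n" "i \<in> {0..n}"
  have "i > d \<or> n - i > e" using n by auto
  then show "f $ i * g $ (n - i) = 0" using f g by auto
qed

lemma degree_le_power: "degree_le d f \<Longrightarrow> degree_le (n * d) (f ^ n)"
  by (induction n) (auto simp: degree_le_mult, simp add: degree_le_def)

lemma degree_le_const [simp]: "degree_le d (fps_const a)"
  by (simp add: degree_le_def)

text \<open>\<open>p\<close> and \<open>q\<close> are the roots of \<open>u\<^sup>2 - u + t\<close>
  and need not be polynomials, but their power sums satisfy \<open>s\<^sub>m\<^sub>+\<^sub>2 =
  s\<^sub>m\<^sub>+\<^sub>1 - t s\<^sub>m\<close>.\<close>

lemma degree_le_power_sum: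
  fixes p q t :: "'a :: comm_ring_1 fps"
  assumes "p + q = 1" "p * q = t" "degree_le 1 t"
  shows "degree_le m (p ^ m + q ^ m)"
proof (induction m rule: induct_nat_012)
  case 0
  then show ?case by (auto simp: degree_le_def numeral_fps_const)
next
  case 1
  then show ?case using assms(1) by (auto simp: degree_le_def)
next
  case (ge2 m)
  have "p ^ Suc (Suc m) + q ^ Suc (Suc m) =
      (p + q) * (p ^ Suc m + q ^ Suc m) - p * q * (p ^ m + q ^ m)"
    by (simp add: algebra_simps)
  then have "p ^ Suc (Suc m) + q ^ Suc (Suc m) = (p ^ Suc m + q ^ Suc m) - t * (p ^ m + q ^ m)"
    by (simp add: assms(1,2))
  moreover have "degree_le (Suc (Suc m)) (t * (p ^ m + q ^ m))"
    using degree_le_mult [OF assms(3) ge2(1)] by (auto intro: degree_le_mono)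
  moreover have "degree_le (Suc (Suc m)) (p ^ Suc m + q ^ Suc m)"
    using ge2(2) by (rule degree_le_mono) simp
  ultimately show ?case by (simp only: degree_le_diff)
qed

lemma prod_fps_const: "(\<Prod>i\<in>A. fps_const (f i)) = fps_const (prod f A)"
  for f :: "'b \<Rightarrow> 'a :: comm_ring_1"
  by (induction A rule: infinite_finite_induct) auto

lemma prod_plus_fps_const:
  fixes u :: "'a :: comm_ring_1 fps"
  shows "(\<Prod>i\<le>r. u + fps_const (y i)) =
      (\<Sum>I\<in>Pow {..r}. fps_const (\<Prod>i\<in>I. y i) * u ^ (Suc r - card I))"
proof -
  have "(\<Prod>i\<le>r. u + fps_const (y i)) =
      (\<Sum>I\<in>Pow {..r}. (\<Prod>i\<in>I. fps_const (y i)) * (\<Prod>i\<in>{..r} - I. u))"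
    by (simp add: prod_add add.commute [of u])
  also have "\<dots> = (\<Sum>I\<in>Pow {..r}. fps_const (\<Prod>i\<in>I. y i) * u ^ (Suc r - card I))"
    by (intro sum.cong refl) (auto simp: prod_fps_const card_Diff_subset finite_subset)
  finally show ?thesis .
qed

text \<open>Expand both products over subsets. A subset of size \<open>j > 0\<close> contributes
  \<open>(p q)\<^sup>d (p\<^sup>l + q\<^sup>l)\<close> with \<open>l = j - 1\<close> and
  \<open>d = r - l\<close>, of degree at most \<open>d + l = r\<close>; the empty set contributes
  \<open>(p q)\<^sup>r (p + q)\<close>.\<close>

lemma degree_le_symmetric_part:
  fixes p q t :: "'a :: comm_ring_1 fps"
  assumes "p + q = 1" "p * q = t" "degree_le 1 t"
  shows "degree_le r (p ^ r * (\<Prod>i\<le>r. q + fps_const (y i)) + q ^ r * (\<Prod>i\<le>r. p + fps_const (y i)))"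
proof -
  have "degree_le r (p ^ r * q ^ (Suc r - j) + q ^ r * p ^ (Suc r - j))" if "j \<le> Suc r" for j
  proof (cases j)
    case 0
    have "p ^ r * q ^ Suc r + q ^ r * p ^ Suc r = (p * q) ^ r * (p + q)"
      by (simp add: algebra_simps power_mult_distrib)
    then show ?thesis
      using degree_le_power [OF assms(3), of r] by (simp add: 0 assms(1,2))
  next
    case (Suc l)
    define d where "d = r - l"
    have r: "r = d + l" using that Suc by (simp add: d_def)
    have "p ^ r * q ^ d + q ^ r * p ^ d = (p * q) ^ d * (p ^ l + q ^ l)"
      by (simp add: r power_add power_mult_distrib algebra_simps)
    moreover have "degree_le (d * 1 + l) (t ^ d * (p ^ l + q ^ l))"
      by (intro degree_le_mult degree_le_power degree_le_power_sum [OF assms] assms(3))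
    ultimately show ?thesis by (simp add: Suc assms(2) r)
  qed
  then have "degree_le (0 + r) (fps_const (\<Prod>i\<in>I. y i) *
      (p ^ r * q ^ (Suc r - card I) + q ^ r * p ^ (Suc r - card I)))" if "I \<in> Pow {..r}" for I
    using that card_mono [of "{..r}" I] by (intro degree_le_mult) auto
  then have "degree_le r (\<Sum>I\<in>Pow {..r}. fps_const (\<Prod>i\<in>I. y i) *
      (p ^ r * q ^ (Suc r - card I) + q ^ r * p ^ (Suc r - card I)))"
    by (intro degree_le_sum) simp
  then show ?thesis
    by (simp only: prod_plus_fps_const sum_distrib_left sum.distrib [symmetric] distrib_left mult.left_commute)
qed

lemma prod_fps_nth_0: "(\<Prod>i\<in>A. f i) $ 0 = (\<Prod>i\<in>A. f i $ 0)"
  for f :: "'b \<Rightarrow> 'a :: comm_ring_1 fps"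
  by (induction A rule: infinite_finite_induct) auto

text \<open>The claimed formulas satisfy the system that determines \<open>g_k\<close>: the first
  part follows by eliminating \<open>E(y, c)\<close>, the second from a degree bound in
  \<open>z\<close>.\<close>

lemma closed_form_solves_system:
  assumes "is_y r y"
  defines "e \<equiv> fps_const (E_prod r y)"
  defines "t \<equiv> fps_X * e\<^sup>2"
  defines "c \<equiv> catalan_at t"
  defines "G \<equiv> c * e / E_prod_at r y c"
  defines "F \<equiv> e * (e - E_prod_at r y c / c) / t"
  shows "G = 1 + fps_X * (F * G)"
    and "F $ k = (\<Sum>I\<in>Pow {..r}. (\<Prod>v\<in>I. mvar v) * G $ (k + card I))"
proof -
  define e' :: "xseries fps" where "e' = fps_const (inverse (E_prod r y))"
  define D where "D = E_prod_at r y c"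
  \<comment> \<open>The equation \<open>c = 1 + t c\<^sup>2\<close> says that
    \<open>p = 1 - q\<close> is the inverse of \<open>c\<close>.\<close>
  define q where "q = t * c"
  define p where "p = 1 - q"
  define P where "P = (\<Prod>i\<le>r. p + fps_const (y i))"
  define Q where "Q = (\<Prod>i\<le>r. q + fps_const (y i))"
  have y0: "mcoeff (y j) {#} = 0" if "j \<le> r" for j
    using assms(1) that by (auto simp: is_y_def PiE_iff)
  have a0: "mcoeff (E_prod r y) {#} = 1" by (rule mcoeff_E_prod_empty [OF y0])
  have ee': "e * e' = 1"
    using mfps_inverse_right [of "E_prod r y"] a0 by (simp add: e_def e'_def)
  have t_eq: "t = fps_X * fps_const ((E_prod r y)\<^sup>2)"
    by (simp add: t_def e_def)
  have c_eq: "c = 1 + t * c\<^sup>2"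
    unfolding c_def t_eq by (rule catalan_at_eq)
  have c0: "c $ 0 = 1" by (subst c_eq) (simp add: t_def)
  have cp: "c * p = 1"
    using c_eq by (simp add: p_def q_def power2_eq_square algebra_simps)
  have "p * q = t * (c * p)" by (simp add: q_def ac_simps)
  with cp have pq: "p + q = 1" "p * q = t" by (simp_all add: p_def)
  \<comment> \<open>As \<open>c p = 1\<close>, each factor \<open>1 + y\<^sub>i c\<close> equals
    \<open>c (p + y\<^sub>i)\<close>.\<close>
  have D_eq: "D = c ^ Suc r * P"
  proof -
    have "c ^ Suc r * P = (\<Prod>i\<le>r. c * (p + fps_const (y i)))"
      by (simp add: P_def prod.distrib del: power_Suc)
    also have "\<dots> = D"
      unfolding D_def E_prod_at_def using cp by (simp add: distrib_left mult.commute)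
    finally show ?thesis by simp
  qed
  have D0: "D $ 0 = E_prod r y"
    by (simp add: D_def E_prod_at_def E_prod_def prod_fps_nth_0 c0)
  have GD: "G * D = c * e"
  proof -
    have "G * D = c * e * (D * inverse D)"
      unfolding G_def by (simp add: fps_divide_eq D0 a0 ac_simps flip: D_def)
    then show ?thesis by (simp add: fps_inverse_right D0 a0)
  qed
  have Dc: "E_prod_at r y c / c = D * p"
  proof -
    have "c * inverse c = 1" by (rule fps_inverse_right) (simp add: c0)
    moreover have "c * p * inverse c = p * (c * inverse c)" by (simp only: ac_simps)
    ultimately have "inverse c = p" by (simp add: cp)
    then show ?thesis by (simp add: fps_divide_eq c0 D_def)
  qed
  \<comment> \<open>At \<open>z = 0\<close> both \<open>E(y, c)\<close> and \<open>e\<close> equal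
    \<open>E(y)\<close> and \<open>p\<close> is 1, so the numerator has no constant term and the
    division by \<open>t\<close> is exact.\<close>
  have tF: "t * F = e * (e - D * p)"
    unfolding F_def Dc t_def
  proof (rule fps_divide_X_mult)
    show "mcoeff (e\<^sup>2 $ 0) {#} \<noteq> 0" by (simp add: e_def mcoeff_mult_empty power2_eq_square a0)
    have "p $ 0 = 1" by (simp add: p_def q_def t_def)
    then show "(e * (e - D * p)) $ 0 = 0" by (simp add: D0) (simp add: e_def)
  qed
  have "(e * e')\<^sup>2 * (fps_X * F * G) = e'\<^sup>2 * (t * F) * G"
    by (simp only: t_def power_mult_distrib ac_simps)
  then have "fps_X * F * G = e'\<^sup>2 * (t * F) * G" by (simp only: ee' power_one mult_1)
  also have "\<dots> = (e * e')\<^sup>2 * G - (e * e')* e' * p * (G * D)"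
    unfolding tF by (simp add: power2_eq_square algebra_simps)
  also have "\<dots> = (e * e')\<^sup>2 * G - (e * e')\<^sup>2 * (c * p)"
    unfolding GD by (simp only: power2_eq_square ac_simps)
  finally show "G = 1 + fps_X * (F * G)"
    using ee' cp by (simp add: mult.assoc)
  let ?\<Pi> = "\<Prod>i\<le>r. fps_X + fps_const (mvar i)"
  \<comment> \<open>The definition of \<open>y\<close> gives
    \<open>e\<^sup>2 x\<^sub>i = y\<^sub>i + y\<^sub>i\<^sup>2\<close>; with
    \<open>p + q = 1\<close> and \<open>p q = t\<close> each factor splits.\<close>
  have PQ: "(e\<^sup>2) ^ Suc r * ?\<Pi> = P * Q"
  proof -
    have "e\<^sup>2 * (fps_X + fps_const (mvar i)) = (p + fps_const (y i)) * (q + fps_const (y i))"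
      if "i \<le> r" for i
    proof -
      have "mvar i = y i * (1 + y i) / (E_prod r y)\<^sup>2"
        using assms(1) [unfolded is_y_def, THEN conjunct2] that by blast
      then have "y_step r y i = y i"
        using mvar_eq_iff_y_step [of r y i, OF y0] by blast
      then have "mvar i * (E_prod r y)\<^sup>2 = y i + (y i)\<^sup>2"
        by (simp add: y_step_def diff_eq_eq)
      then have "e\<^sup>2 * fps_const (mvar i) = fps_const (y i) + fps_const (y i) * fps_const (y i)"
        by (simp add: e_def power2_eq_square mult.commute)
      moreover have "(p + fps_const (y i)) * (q + fps_const (y i)) =
          p * q + (p + q) * fps_const (y i) + fps_const (y i) * fps_const (y i)"
        by (simp only: algebra_simps)
      moreover have "e\<^sup>2 * (fps_X + fps_const (mvar i)) = t + e\<^sup>2 * fps_const (mvar i)"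
        by (simp only: t_def distrib_right mult.commute [of "e\<^sup>2"])
      ultimately show ?thesis by (simp only: pq mult_1 add.assoc)
    qed
    then have "(\<Prod>i\<le>r. e\<^sup>2 * (fps_X + fps_const (mvar i))) =
        (\<Prod>i\<le>r. (p + fps_const (y i)) * (q + fps_const (y i)))"
      by (intro prod.cong) auto
    then show ?thesis by (simp add: P_def Q_def prod.distrib del: power_Suc)
  qed
  have cpr: "c ^ n * p ^ n = 1" for n using cp by (simp flip: power_mult_distrib)
  have GP: "G * P = p ^ r * e"
  proof -
    have "c ^ Suc r * p ^ Suc r * (G * P) = p ^ Suc r * (G * D)"
      by (simp only: D_eq ac_simps)
    then have "G * P = p ^ Suc r * (G * D)" by (simp only: cpr mult_1)
    also have "\<dots> = p ^ r * (c * p) * e" unfolding GD by (simp add: ac_simps)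
    finally show ?thesis by (simp add: cp)
  qed
  have tF': "t ^ Suc r * F = t ^ r * e\<^sup>2 - e * (q ^ r * P)"
  proof -
    have "t ^ Suc r * F = t ^ r * (t * F)" by (simp add: ac_simps)
    also have "\<dots> = t ^ r * e\<^sup>2 - e * ((t * c) ^ r * (c * p) * P)"
      unfolding tF D_eq by (simp add: power_mult_distrib power2_eq_square algebra_simps)
    finally show ?thesis by (simp add: cp q_def)
  qed
  \<comment> \<open>If \<open>H\<close> has degree at most \<open>r\<close>, then the coefficients
    of \<open>G * ?\<Pi>\<close> from \<open>z\<^sup>r\<^sup>+\<^sup>1\<close> on are exactly those
    of \<open>F\<close>.\<close>
  define H where "H = G * ?\<Pi> - fps_X ^ Suc r * F"
  have "(e\<^sup>2) ^ Suc r * H = G * (P * Q) - t ^ Suc r * F"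
    unfolding H_def PQ [symmetric] t_def
    by (simp add: power_mult_distrib algebra_simps del: power_Suc)
  also have "\<dots> = e * (p ^ r * Q + q ^ r * P) - t ^ r * e\<^sup>2"
    unfolding tF' mult.assoc [symmetric] GP by (simp add: algebra_simps)
  finally have eH: "(e\<^sup>2) ^ Suc r * H = e * (p ^ r * Q + q ^ r * P) - t ^ r * e\<^sup>2" .
  have "degree_le 1 t" by (auto simp: degree_le_def t_eq)
  then have "degree_le r (p ^ r * Q + q ^ r * P)" "degree_le r (t ^ r)"
    unfolding P_def Q_def using degree_le_symmetric_part [OF pq] degree_le_power [of 1 t r] by simp_all
  then have "degree_le (0 + r) (e * (p ^ r * Q + q ^ r * P) - t ^ r * e\<^sup>2)"
    using degree_le_mult [of 0 e] degree_le_mult [of r "t ^ r" 0 "e\<^sup>2"]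
    by (intro degree_le_diff) (simp_all add: e_def)
  \<comment> \<open>Multiplying by powers of \<open>e'\<close>, which are free of \<open>z\<close>,
    removes the factor in front of \<open>H\<close>.\<close>
  then have "degree_le (0 + r) ((e'\<^sup>2) ^ Suc r * ((e\<^sup>2) ^ Suc r * H))"
    unfolding eH by (intro degree_le_mult) (simp_all add: e'_def)
  moreover have "(e'\<^sup>2) ^ Suc r * ((e\<^sup>2) ^ Suc r * H) = ((e * e')\<^sup>2) ^ Suc r * H"
    by (simp only: power_mult_distrib ac_simps)
  ultimately have "degree_le r H" by (simp add: ee')
  then have "H $ (k + Suc r) = 0" by (simp add: degree_le_def)
  then have "F $ k = (G * ?\<Pi>) $ (k + Suc r)"
    by (simp add: H_def fps_X_power_mult_nth del: power_Suc)
  also have "\<dots> = (\<Sum>I\<in>Pow {..r}. (\<Prod>v\<in>I. mvar v) * G $ (k + card I))"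
    unfolding prod_plus_fps_const sum_distrib_left fps_sum_nth
  proof (rule sum.cong)
    fix I assume "I \<in> Pow {..r}"
    then have I: "card I \<le> Suc r" using card_mono [of "{..r}" I] by auto
    have "G * (fps_const (\<Prod>v\<in>I. mvar v) * fps_X ^ (Suc r - card I)) =
        fps_const (\<Prod>v\<in>I. mvar v) * (fps_X ^ (Suc r - card I) * G)"
      by (simp only: ac_simps)
    moreover have "k + Suc r - (Suc r - card I) = k + card I" "\<not> k + Suc r < Suc r - card I"
      using I by auto
    ultimately show "(G * (fps_const (\<Prod>v\<in>I. mvar v) * fps_X ^ (Suc r - card I))) $ (k + Suc r) =
        (\<Prod>v\<in>I. mvar v) * G $ (k + card I)"
      by (simp only: fps_mult_left_const_nth fps_X_power_mult_nth if_False)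
  qed simp
  finally show "F $ k = (\<Sum>I\<in>Pow {..r}. (\<Prod>v\<in>I. mvar v) * G $ (k + card I))" .
qed

theorem theorem3:
  fixes r :: nat
  assumes "r \<ge> 1"
  shows "(\<exists>!y. is_y r y) \<and>
    (\<forall>y. is_y r y \<longrightarrow>
      (let E = fps_const (E_prod r y);
           t = fps_X * E\<^sup>2;
           c = catalan_at t
       in G_series r = c * E / E_prod_at r y c \<and>
          F_series r = E * (E - E_prod_at r y c / c) / t))"
proof (intro conjI ex1_is_y allI impI)
  fix y assume y: "is_y r y"
  define E where "E = fps_const (E_prod r y)"
  define t where "t = fps_X * E\<^sup>2"
  define c where "c = catalan_at t"
  define G where "G = c * E / E_prod_at r y c"
  define F where "F = E * (E - E_prod_at r y c / c) / t"
  note defs = E_def t_def c_def G_def F_def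
  have G: "G = 1 + fps_X * (F * G)"
    unfolding defs by (rule closed_form_solves_system(1) [OF y])
  have F: "F $ k = (\<Sum>I\<in>Pow {..r}. (\<Prod>v\<in>I. mvar v) * G $ (k + card I))" for k
    unfolding defs by (rule closed_form_solves_system(2) [OF y])
  \<comment> \<open>The combinatorial series and the closed form solve the same system, which has
    only one solution.\<close>
  have "g_k r = fps_nth G"
  proof (rule catalytic_system_unique [where r = r])
    show "fps_nth G 0 = 1" by (subst G) simp
    show "fps_nth G (Suc k) = (\<Sum>i\<le>k. (\<Sum>I\<in>Pow {..r}. (\<Prod>v\<in>I. mvar v) * G $ (i + card I)) * G $ (k - i))" for k
    proof -
      have "G $ Suc k = (F * G) $ k" by (subst G) simp
      then show ?thesis by (simp add: fps_mult_nth atLeast0AtMost flip: F)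
    qed
  qed (simp_all only: g_k_0 [OF assms] g_k_Suc [OF assms] f_k_eq)
  then have "G_series r = G" "F_series r = F"
    by (auto simp: G_series_def F_series_def f_k_eq F fps_eq_iff)
  then show "let E = fps_const (E_prod r y); t = fps_X * E\<^sup>2; c = catalan_at t
      in G_series r = c * E / E_prod_at r y c \<and> F_series r = E * (E - E_prod_at r y c / c) / t"
    unfolding Let_def defs by blast
qed

end
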